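(* Let $V$ be a simple module over $\mathfrak{b}=\bigoplus_{m\geq 0}(\mathbb{C}L_m\oplus\mathbb{C}G_m)\oplus\mathbb{C}c$, and assume that there exists $t\in\mathbb{Z}_+$ such that (1) the action of $L_t$ on $V$ is injective and (2) $L_iV=0$ for all $i>t$. Then the induced module $\mathrm{Ind}(V)=U(\mathcal{R})\otimes_{U(\mathfrak{b})}V$ is a simple smooth $\mathcal{R}$-module.
   Context: The Ramond algebra $\mathcal{R}=\mathcal{R}_{\bar 0}\oplus\mathcal{R}_{\bar 1}$ is the Lie superalgebra with basis $\{L_m,G_m,c\mid m\in\mathbb{Z}\}$, where $\mathcal{R}_{\bar 0}=\mathrm{span}\{L_m,c\}$, $\mathcal{R}_{\bar 1}=\mathrm{span}\{G_m\}$, and brackets $[L_m,L_n]=(m-n)L_{m+n}+\delta_{m+n,0}\frac{m^3-m}{12}c$, $[L_m,G_n]=(\frac m2-n)G_{m+n}$, $[G_m,G_n]=2L_{m+n}+\frac13\delta_{m+n,0}(m^2-\frac14)c$, $[\mathcal{R},c]=0$. Modules are $\mathbb{Z}_2$-graded (super)modules; simple means no nonzero proper graded submodules. For $m\in\mathbb{Z}$ let $\mathcal{R}_m=\mathrm{span}\{L_m,G_m,\delta_{m,0}c\}$. An $\mathcal{R}$-module $M$ is smooth if for every $v\in M$ there exists $n\in\mathbb{N}$ with $\mathcal{R}_mv=0$ for all $m>n$. *)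

theory Defs
  imports Complex_Main "HOL-Library.Function_Algebras"
begin

datatype rgen = RL int | RG int | RC

fun odd_gen :: "rgen \<Rightarrow> bool" where
  "odd_gen (RG _) = True"
| "odd_gen _ = False"

text \<open>The (super)bracket of two basis elements, as a formal linear combination
  (list of coefficient/basis-element pairs).\<close>
fun rbr :: "rgen \<Rightarrow> rgen \<Rightarrow> (complex \<times> rgen) list" where
  "rbr (RL m) (RL n) =
     [(of_int (m - n), RL (m + n)),
      (if m + n = 0 then of_int (m ^ 3 - m) / 12 else 0, RC)]"
| "rbr (RL m) (RG n) = [(of_int m / 2 - of_int n, RG (m + n))]"
| "rbr (RG n) (RL m) = [(- (of_int m / 2 - of_int n), RG (m + n))]"
| "rbr (RG m) (RG n) =
     [(2, RL (m + n)),
      (if m + n = 0 then (of_int m ^ 2 - 1 / 4) / 3 else 0, RC)]"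
| "rbr RC _ = []"
| "rbr _ RC = []"

fun in_b :: "rgen \<Rightarrow> bool" where
  "in_b (RL m) = (m \<ge> 0)"
| "in_b (RG m) = (m \<ge> 0)"
| "in_b RC = True"

definition in_Rm :: "int \<Rightarrow> rgen \<Rightarrow> bool" where
  "in_Rm m x \<longleftrightarrow> x = RL m \<or> x = RG m \<or> (m = 0 \<and> x = RC)"

definition b_supermodule ::
  "(complex \<Rightarrow> 'v::ab_group_add \<Rightarrow> 'v) \<Rightarrow> 'v set \<Rightarrow> 'v set \<Rightarrow> (rgen \<Rightarrow> 'v \<Rightarrow> 'v) \<Rightarrow> bool" where
  "b_supermodule scale V0 V1 act \<longleftrightarrow>
     vector_space scale \<and>
     module.subspace scale V0 \<and> module.subspace scale V1 \<and>
     V0 \<inter> V1 = {0} \<and> (\<forall>v. \<exists>a\<in>V0. \<exists>b\<in>V1. v = a + b) \<and>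
     (\<forall>x. in_b x \<longrightarrow> Vector_Spaces.linear scale scale (act x)) \<and>
     (\<forall>x. in_b x \<longrightarrow>
        (if odd_gen x then act x ` V0 \<subseteq> V1 \<and> act x ` V1 \<subseteq> V0
         else act x ` V0 \<subseteq> V0 \<and> act x ` V1 \<subseteq> V1)) \<and>
     (\<forall>x y v. in_b x \<longrightarrow> in_b y \<longrightarrow>
        (if odd_gen x \<and> odd_gen y then act x (act y v) + act y (act x v)
         else act x (act y v) - act y (act x v))
        = (\<Sum>(a, g)\<leftarrow>rbr x y. scale a (act g v)))"

definition simple_b_supermodule ::
  "(complex \<Rightarrow> 'v::ab_group_add \<Rightarrow> 'v) \<Rightarrow> 'v set \<Rightarrow> 'v set \<Rightarrow> (rgen \<Rightarrow> 'v \<Rightarrow> 'v) \<Rightarrow> bool" where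
  "simple_b_supermodule scale V0 V1 act \<longleftrightarrow>
     b_supermodule scale V0 V1 act \<and> (\<exists>v::'v. v \<noteq> 0) \<and>
     (\<forall>W. module.subspace scale W \<and> (\<forall>x. in_b x \<longrightarrow> act x ` W \<subseteq> W) \<and>
          (\<forall>w\<in>W. \<exists>a\<in>W \<inter> V0. \<exists>b\<in>W \<inter> V1. w = a + b)
          \<longrightarrow> W = {0} \<or> W = UNIV)"

text \<open>T(R) (x)_C V is modelled as the finitely supported functions from words in the
  basis of R (the monomial basis of the tensor algebra T(R)) to V; the word
  x1 x2 ... xk with value v stands for x1 x2 ... xk (x) v.\<close>
definition indF :: "(rgen list \<Rightarrow> 'v::zero) set" where
  "indF = {f. finite {w. f w \<noteq> 0}}"

definition single :: "rgen list \<Rightarrow> 'v::zero \<Rightarrow> rgen list \<Rightarrow> 'v" where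
  "single w v = (\<lambda>u. if u = w then v else 0)"

definition fscale :: "(complex \<Rightarrow> 'v \<Rightarrow> 'v) \<Rightarrow> complex \<Rightarrow> (rgen list \<Rightarrow> 'v) \<Rightarrow> rgen list \<Rightarrow> 'v" where
  "fscale scale a f = (\<lambda>w. scale a (f w))"

text \<open>Relations: the two-sided ideal defining U(R) (supercommutators), and the
  balancing relations  u x (x) v = u (x) x.v  for x in b.\<close>
definition ind_rels ::
  "(complex \<Rightarrow> 'v::ab_group_add \<Rightarrow> 'v) \<Rightarrow> (rgen \<Rightarrow> 'v \<Rightarrow> 'v) \<Rightarrow> (rgen list \<Rightarrow> 'v) set" where
  "ind_rels scale act =
     {single (u @ [x, y] @ u') v
        - (if odd_gen x \<and> odd_gen y then - single (u @ [y, x] @ u') v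
           else single (u @ [y, x] @ u') v)
        - (\<Sum>(a, g)\<leftarrow>rbr x y. fscale scale a (single (u @ [g] @ u') v))
      | u x y u' v. True}
   \<union> {single (u @ [x]) v - single u (act x v) | u x v. in_b x}"

text \<open>The kernel K of T(R) (x) V -> Ind(V): the span of the relations.\<close>
definition indK ::
  "(complex \<Rightarrow> 'v::ab_group_add \<Rightarrow> 'v) \<Rightarrow> (rgen \<Rightarrow> 'v \<Rightarrow> 'v) \<Rightarrow> (rgen list \<Rightarrow> 'v) set" where
  "indK scale act = module.span (fscale scale) (ind_rels scale act)"

text \<open>Left action of a basis element of R: x . (w (x) v) = (x w) (x) v.\<close>
definition lact :: "rgen \<Rightarrow> (rgen list \<Rightarrow> 'v::zero) \<Rightarrow> rgen list \<Rightarrow> 'v" where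
  "lact x f = (\<lambda>w. case w of [] \<Rightarrow> 0 | y # u \<Rightarrow> if y = x then f u else 0)"

definition word_odd :: "rgen list \<Rightarrow> bool" where
  "word_odd w = odd (length (filter odd_gen w))"

definition indF_par :: "'v::zero set \<Rightarrow> 'v set \<Rightarrow> bool \<Rightarrow> (rgen list \<Rightarrow> 'v) set" where
  "indF_par V0 V1 p = {f \<in> indF. \<forall>w. f w \<in> (if word_odd w = p then V0 else V1)}"

text \<open>Ind(V) = indF / indK.  It is an R-module via lact (the action descends to the
  quotient); simplicity and smoothness are phrased on the quotient, using the
  correspondence between (graded) submodules of indF / indK and (graded)
  submodules W of indF containing indK.\<close>
definition ind_is_R_module :: "(complex \<Rightarrow> 'v::ab_group_add \<Rightarrow> 'v) \<Rightarrow> (rgen \<Rightarrow> 'v \<Rightarrow> 'v) \<Rightarrow> bool" where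
  "ind_is_R_module scale act \<longleftrightarrow>
     (\<forall>x. \<forall>k\<in>indK scale act. lact x k \<in> indK scale act)"

definition ind_simple ::
  "(complex \<Rightarrow> 'v::ab_group_add \<Rightarrow> 'v) \<Rightarrow> 'v set \<Rightarrow> 'v set \<Rightarrow> (rgen \<Rightarrow> 'v \<Rightarrow> 'v) \<Rightarrow> bool" where
  "ind_simple scale V0 V1 act \<longleftrightarrow>
     (let K = indK scale act in
       (\<exists>f\<in>indF. f \<notin> K) \<and>
       (\<forall>W. K \<subseteq> W \<and> W \<subseteq> indF \<and>
            (\<forall>f\<in>W. \<forall>g\<in>W. f + g \<in> W) \<and> (\<forall>a. \<forall>f\<in>W. fscale scale a f \<in> W) \<and>
            (\<forall>x. \<forall>f\<in>W. lact x f \<in> W) \<and>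
            (\<forall>f\<in>W. \<exists>f0\<in>W \<inter> indF_par V0 V1 False. \<exists>f1\<in>W \<inter> indF_par V0 V1 True.
                f - (f0 + f1) \<in> K)
            \<longrightarrow> W = K \<or> W = indF))"

definition ind_smooth :: "(complex \<Rightarrow> 'v::ab_group_add \<Rightarrow> 'v) \<Rightarrow> (rgen \<Rightarrow> 'v \<Rightarrow> 'v) \<Rightarrow> bool" where
  "ind_smooth scale act \<longleftrightarrow>
     (\<forall>f\<in>indF. \<exists>n::nat. \<forall>m::int. m > int n \<longrightarrow>
        (\<forall>x. in_Rm m x \<longrightarrow> lact x f \<in> indK scale act))"

end

theory Submission
  imports Defs "HOL-Library.Multiset"
begin

text \<open>That \<open>Ind(V)\<close> is nonzero is the Poincare--Birkhoff--Witt theorem, obtained here by Bergman's diamond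
  lemma: words are rewritten by sorting the letters with those of \<open>b\<close> last, squares of odd letters are
  replaced by half a bracket, and final letters in \<open>b\<close> act on \<open>V\<close>. The overlaps \<open>x y z\<close> resolve by the
  super Jacobi identity, the overlap of a swap with an absorption by the module law of \<open>V\<close>.

  For simplicity, filter \<open>Ind(V)\<close> by the weight (minus the degree) of words of negative letters. Take an
  element of a submodule and let \<open>j\<close> be minimal such that a letter of degree \<open>-j\<close> occurs in its component
  of top weight. Modulo lower weights, \<open>L\<^bsub>j+t\<^esub>\<close> and \<open>G\<^bsub>j+t\<^esub>\<close> act on this component as derivations which
  only touch \<open>L\<^bsub>-j\<^esub>\<close> and \<open>G\<^bsub>-j\<^esub>\<close>, replacing them by multiples of \<open>L\<^sub>t\<close> and \<open>G\<^sub>t\<close> acting on \<open>V\<close>. On \<open>V\<close>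
  these two commute, \<open>G\<^sub>t\<close> squares to zero and \<open>L\<^sub>t\<close> is injective, so the two derivations do not both
  vanish. Iterating, the submodule contains a nonzero vector of \<open>V\<close>, hence \<open>V\<close>. Only the spanning half of
  the Poincare--Birkhoff--Witt theorem is used in this descent.\<close>

subsection \<open>Brackets and the super Jacobi identity\<close>

text \<open>The order in which letters are sorted: by degree, \<open>L_m\<close> before
  \<open>G_m\<close>. The factor 3 leaves a residue class free for \<open>c\<close>, whose value 2
  puts it between \<open>G_0\<close> and \<open>L_1\<close>. So keys are distinct and the letters of
  b are those of nonnegative key, which sorting moves to the end.\<close>

fun key :: "rgen \<Rightarrow> int" where
  "key (RL m) = 3 * m"
| "key (RG m) = 3 * m + 1"
| "key RC = 2"

lemma in_b_iff_key: "in_b x \<longleftrightarrow> key x \<ge> 0"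
  by (cases x) auto

lemma key_inject: "key x = key y \<longleftrightarrow> x = y"
  by (cases x; cases y; simp; presburger)

definition sg :: "rgen \<Rightarrow> rgen \<Rightarrow> complex" where
  "sg x y = (if odd_gen x \<and> odd_gen y then - 1 else 1)"

definition lc :: "(complex \<Rightarrow> 'm::ab_group_add \<Rightarrow> 'm) \<Rightarrow> (complex \<times> 'x) list \<Rightarrow> ('x \<Rightarrow> 'm) \<Rightarrow> 'm" where
  "lc s l f = (\<Sum>(a, g)\<leftarrow>l. s a (f g))"

lemma lc_Nil [simp]: "lc s [] f = 0"
  and lc_Cons [simp]: "lc s ((a, g) # l) f = s a (f g) + lc s l f"
  by (simp_all add: lc_def)

lemma lc_cong: "(\<And>a g. (a, g) \<in> set l \<Longrightarrow> f g = f' g) \<Longrightarrow> lc s l f = lc s l f'"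
  unfolding lc_def by (intro arg_cong[where f = sum_list] map_cong) auto

lemma rbr_odd: "(a, g) \<in> set (rbr x y) \<Longrightarrow> odd_gen g \<longleftrightarrow> odd_gen x \<noteq> odd_gen y"
  by (cases x; cases y; auto)

lemma rbr_in_b: "(a, g) \<in> set (rbr x y) \<Longrightarrow> in_b x \<Longrightarrow> in_b y \<Longrightarrow> in_b g"
  by (cases x; cases y; auto)

locale cvector_space = vector_space scale
  for scale :: "complex \<Rightarrow> 'm::ab_group_add \<Rightarrow> 'm" (infixr "*s" 75)
begin

lemma lc_add: "lc scale l (\<lambda>g. f g + h g) = lc scale l f + lc scale l h"
  by (induction l) (auto simp: scale_right_distrib)

lemma lc_scale: "lc scale l (\<lambda>g. c *s f g) = c *s lc scale l f"
  by (induction l) (auto simp: scale_right_distrib mult.commute)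

lemma lc_swap: "lc scale l (\<lambda>g. lc scale l' (f g)) = lc scale l' (\<lambda>g'. lc scale l (\<lambda>g. f g g'))"
proof (induction l)
  case Nil
  then show ?case by (induction l') auto
next
  case (Cons p l)
  then show ?case by (cases p) (simp add: lc_add lc_scale)
qed

lemma lc_rbr_antisym: "lc scale (rbr x y) f = (- sg x y) *s lc scale (rbr y x) f"
proof (cases x; cases y)
  fix m n assume *: "x = RL m" "y = RL n"
  show ?thesis
  proof (cases "m = - n")
    case True
    have e: "(of_int (m ^ 3 - m) / 12 :: complex) = - (of_int (n ^ 3 - n) / 12)"
      unfolding True by (simp add: field_simps)
    show ?thesis
      using True e unfolding * by (simp add: sg_def scale_left_diff_distrib)
  next
    case False
    then have "m + n \<noteq> 0" "n + m \<noteq> 0" by auto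
    then show ?thesis
      unfolding * by (simp add: sg_def scale_left_diff_distrib add.commute)
  qed
next
  fix m n assume *: "x = RG m" "y = RG n"
  have "m + n = 0 \<longleftrightarrow> m = - n" by auto
  then show ?thesis
    unfolding * by (simp add: sg_def add.commute)
qed (auto simp: sg_def scale_left_diff_distrib add.commute)

lemma lin2_eq:
  assumes "A = A' + c * A''" "B = B' + c * B''"
  shows "A *s p + B *s q = (A' *s p + B' *s q) + c *s (A'' *s p + B'' *s q)"
  using assms by (simp add: scale_left_distrib scale_right_distrib)

lemma lin1_eq:
  assumes "A = A' + c * A''"
  shows "A *s p = A' *s p + c *s (A'' *s p)"
  using assms by (simp add: scale_left_distrib)

text \<open>Both sides are combinations of one generator of degree \<open>l + m + n\<close> and, in
  even total parity, of \<open>c\<close>. So each case without \<open>c\<close> among the arguments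
  compares one or two coefficients by \<open>lin1_eq\<close> or \<open>lin2_eq\<close>; the central
  ones vanish unless \<open>l = - m - n\<close>, where they give a polynomial identity.\<close>

lemma rbr_jacobi:
  "lc scale (rbr y z) (\<lambda>g. lc scale (rbr x g) f) =
   lc scale (rbr x y) (\<lambda>g. lc scale (rbr g z) f) + sg x y *s lc scale (rbr x z) (\<lambda>g. lc scale (rbr y g) f)"
proof (cases x; cases y; cases z)
  fix l m n assume *: "x = RL l" "y = RL m" "z = RL n"
  have e: "l + (m + n) = 0 \<longleftrightarrow> l = - m - n" by auto
  have 1: "lc scale (rbr y z) (\<lambda>g. lc scale (rbr x g) f)
    = (of_int (m-n) * of_int (l-(m+n))) *s f (RL (l+m+n))
      + (of_int (m-n) * (if l = - m - n then (of_int (l^3-l)/12) else 0)) *s f RC"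
    unfolding * by (simp add: add_ac scale_right_distrib e)
  have 2: "lc scale (rbr x y) (\<lambda>g. lc scale (rbr g z) f)
    = (of_int (l-m) * of_int ((l+m)-n)) *s f (RL (l+m+n))
      + (of_int (l-m) * (if l = - m - n then (of_int ((l+m)^3-(l+m))/12) else 0)) *s f RC"
    unfolding * by (simp add: add_ac scale_right_distrib e)
  have 3: "lc scale (rbr x z) (\<lambda>g. lc scale (rbr y g) f)
    = (of_int (l-n) * of_int (m-(l+n))) *s f (RL (l+m+n))
      + (of_int (l-n) * (if l = - m - n then (of_int (m^3-m)/12) else 0)) *s f RC"
    unfolding * by (simp add: add_ac scale_right_distrib e)
  have 4: "sg x y = 1" unfolding * sg_def by simp
  show ?thesis
    unfolding 1 2 3 4 by (rule lin2_eq; cases "l = - m - n"; simp?; simp add: field_simps power2_eq_square power3_eq_cube)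
next
  fix l m n assume *: "x = RL l" "y = RL m" "z = RG n"
  have 1: "lc scale (rbr y z) (\<lambda>g. lc scale (rbr x g) f)
    = ((of_int m/2 - of_int n) * (of_int l/2 - of_int (m+n))) *s f (RG (l+m+n))"
    unfolding * by (simp add: add_ac scale_right_distrib)
  have 2: "lc scale (rbr x y) (\<lambda>g. lc scale (rbr g z) f)
    = (of_int (l-m) * (of_int (l+m)/2 - of_int n)) *s f (RG (l+m+n))"
    unfolding * by (simp add: add_ac scale_right_distrib)
  have 3: "lc scale (rbr x z) (\<lambda>g. lc scale (rbr y g) f)
    = ((of_int l/2 - of_int n) * (of_int m/2 - of_int (l+n))) *s f (RG (l+m+n))"
    unfolding * by (simp add: add_ac scale_right_distrib)
  have 4: "sg x y = 1" unfolding * sg_def by simp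
  show ?thesis
    unfolding 1 2 3 4 by (rule lin1_eq; simp add: field_simps power2_eq_square power3_eq_cube)
next
  fix l m n assume *: "x = RL l" "y = RG m" "z = RL n"
  have 1: "lc scale (rbr y z) (\<lambda>g. lc scale (rbr x g) f)
    = ((-(of_int n/2 - of_int m)) * (of_int l/2 - of_int (m+n))) *s f (RG (l+m+n))"
    unfolding * by (simp add: add_ac scale_right_distrib)
  have 2: "lc scale (rbr x y) (\<lambda>g. lc scale (rbr g z) f)
    = ((of_int l/2 - of_int m) * (-(of_int n/2 - of_int (l+m)))) *s f (RG (l+m+n))"
    unfolding * by (simp add: add_ac scale_right_distrib)
  have 3: "lc scale (rbr x z) (\<lambda>g. lc scale (rbr y g) f)
    = (of_int (l-n) * (-(of_int (l+n)/2 - of_int m))) *s f (RG (l+m+n))"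
    unfolding * by (simp add: add_ac scale_right_distrib)
  have 4: "sg x y = 1" unfolding * sg_def by simp
  show ?thesis
    unfolding 1 2 3 4 by (rule lin1_eq; simp add: field_simps power2_eq_square power3_eq_cube)
next
  fix l m n assume *: "x = RL l" "y = RG m" "z = RG n"
  have e: "l + (m + n) = 0 \<longleftrightarrow> l = - m - n" by auto
  have 1: "lc scale (rbr y z) (\<lambda>g. lc scale (rbr x g) f)
    = (2 * of_int (l-(m+n))) *s f (RL (l+m+n))
      + (2 * (if l = - m - n then (of_int (l^3-l)/12) else 0)) *s f RC"
    unfolding * by (simp add: add_ac scale_right_distrib e)
  have 2: "lc scale (rbr x y) (\<lambda>g. lc scale (rbr g z) f)
    = ((of_int l/2 - of_int m) * 2) *s f (RL (l+m+n))
      + ((of_int l/2 - of_int m) * (if l = - m - n then ((of_int (l+m)^2 - 1/4)/3) else 0)) *s f RC"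
    unfolding * by (simp add: add_ac scale_right_distrib e)
  have 3: "lc scale (rbr x z) (\<lambda>g. lc scale (rbr y g) f)
    = ((of_int l/2 - of_int n) * 2) *s f (RL (l+m+n))
      + ((of_int l/2 - of_int n) * (if l = - m - n then ((of_int m^2 - 1/4)/3) else 0)) *s f RC"
    unfolding * by (simp add: add_ac scale_right_distrib e)
  have 4: "sg x y = 1" unfolding * sg_def by simp
  show ?thesis
    unfolding 1 2 3 4 by (rule lin2_eq; cases "l = - m - n"; simp?; simp add: field_simps power2_eq_square power3_eq_cube)
next
  fix l m n assume *: "x = RG l" "y = RL m" "z = RL n"
  have 1: "lc scale (rbr y z) (\<lambda>g. lc scale (rbr x g) f)
    = (of_int (m-n) * (-(of_int (m+n)/2 - of_int l))) *s f (RG (l+m+n))"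
    unfolding * by (simp add: add_ac scale_right_distrib)
  have 2: "lc scale (rbr x y) (\<lambda>g. lc scale (rbr g z) f)
    = ((-(of_int m/2 - of_int l)) * (-(of_int n/2 - of_int (l+m)))) *s f (RG (l+m+n))"
    unfolding * by (simp add: add_ac scale_right_distrib)
  have 3: "lc scale (rbr x z) (\<lambda>g. lc scale (rbr y g) f)
    = ((-(of_int n/2 - of_int l)) * (of_int m/2 - of_int (l+n))) *s f (RG (l+m+n))"
    unfolding * by (simp add: add_ac scale_right_distrib)
  have 4: "sg x y = 1" unfolding * sg_def by simp
  show ?thesis
    unfolding 1 2 3 4 by (rule lin1_eq; simp add: field_simps power2_eq_square power3_eq_cube)
next
  fix l m n assume *: "x = RG l" "y = RL m" "z = RG n"
  have e: "l + (m + n) = 0 \<longleftrightarrow> l = - m - n" by auto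
  have 1: "lc scale (rbr y z) (\<lambda>g. lc scale (rbr x g) f)
    = ((of_int m/2 - of_int n) * 2) *s f (RL (l+m+n))
      + ((of_int m/2 - of_int n) * (if l = - m - n then ((of_int l^2 - 1/4)/3) else 0)) *s f RC"
    unfolding * by (simp add: add_ac scale_right_distrib e)
  have 2: "lc scale (rbr x y) (\<lambda>g. lc scale (rbr g z) f)
    = ((-(of_int m/2 - of_int l)) * 2) *s f (RL (l+m+n))
      + ((-(of_int m/2 - of_int l)) * (if l = - m - n then ((of_int (l+m)^2 - 1/4)/3) else 0)) *s f RC"
    unfolding * by (simp add: add_ac scale_right_distrib e)
  have 3: "lc scale (rbr x z) (\<lambda>g. lc scale (rbr y g) f)
    = (2 * of_int (m-(l+n))) *s f (RL (l+m+n))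
      + (2 * (if l = - m - n then (of_int (m^3-m)/12) else 0)) *s f RC"
    unfolding * by (simp add: add_ac scale_right_distrib e)
  have 4: "sg x y = 1" unfolding * sg_def by simp
  show ?thesis
    unfolding 1 2 3 4 by (rule lin2_eq; cases "l = - m - n"; simp?; simp add: field_simps power2_eq_square power3_eq_cube)
next
  fix l m n assume *: "x = RG l" "y = RG m" "z = RL n"
  have e: "l + (m + n) = 0 \<longleftrightarrow> l = - m - n" by auto
  have 1: "lc scale (rbr y z) (\<lambda>g. lc scale (rbr x g) f)
    = ((-(of_int n/2 - of_int m)) * 2) *s f (RL (l+m+n))
      + ((-(of_int n/2 - of_int m)) * (if l = - m - n then ((of_int l^2 - 1/4)/3) else 0)) *s f RC"
    unfolding * by (simp add: add_ac scale_right_distrib e)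
  have 2: "lc scale (rbr x y) (\<lambda>g. lc scale (rbr g z) f)
    = (2 * of_int ((l+m)-n)) *s f (RL (l+m+n))
      + (2 * (if l = - m - n then (of_int ((l+m)^3-(l+m))/12) else 0)) *s f RC"
    unfolding * by (simp add: add_ac scale_right_distrib e)
  have 3: "lc scale (rbr x z) (\<lambda>g. lc scale (rbr y g) f)
    = ((-(of_int n/2 - of_int l)) * 2) *s f (RL (l+m+n))
      + ((-(of_int n/2 - of_int l)) * (if l = - m - n then ((of_int m^2 - 1/4)/3) else 0)) *s f RC"
    unfolding * by (simp add: add_ac scale_right_distrib e)
  have 4: "sg x y = (-1)" unfolding * sg_def by simp
  show ?thesis
    unfolding 1 2 3 4 by (rule lin2_eq; cases "l = - m - n"; simp?; simp add: field_simps power2_eq_square power3_eq_cube)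
next
  fix l m n assume *: "x = RG l" "y = RG m" "z = RG n"
  have 1: "lc scale (rbr y z) (\<lambda>g. lc scale (rbr x g) f)
    = (2 * (-(of_int (m+n)/2 - of_int l))) *s f (RG (l+m+n))"
    unfolding * by (simp add: add_ac scale_right_distrib)
  have 2: "lc scale (rbr x y) (\<lambda>g. lc scale (rbr g z) f)
    = (2 * (of_int (l+m)/2 - of_int n)) *s f (RG (l+m+n))"
    unfolding * by (simp add: add_ac scale_right_distrib)
  have 3: "lc scale (rbr x z) (\<lambda>g. lc scale (rbr y g) f)
    = (2 * (-(of_int (l+n)/2 - of_int m))) *s f (RG (l+m+n))"
    unfolding * by (simp add: add_ac scale_right_distrib)
  have 4: "sg x y = (-1)" unfolding * sg_def by simp
  show ?thesis
    unfolding 1 2 3 4 by (rule lin1_eq; simp add: field_simps power2_eq_square power3_eq_cube)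
qed (simp_all add: sg_def)

end

section \<open>Rewriting rules and the resolution of overlaps\<close>

text \<open>A repeated odd letter counts as bad although its keys are in order: its square is half a
  bracket and does not occur in a Poincare-Birkhoff-Witt monomial.\<close>

definition bad :: "rgen \<Rightarrow> rgen \<Rightarrow> bool" where
  "bad x y \<longleftrightarrow> key y < key x \<or> x = y \<and> odd_gen x"

text \<open>The reducts of the subword \<open>x y\<close> with their coefficients; for equal odd letters \<open>x x = [x, x] / 2\<close>.\<close>
definition rlist :: "rgen \<Rightarrow> rgen \<Rightarrow> (complex \<times> rgen list) list" where
  "rlist x y = (if x = y then map (\<lambda>(a, g). (a / 2, [g])) (rbr x y)
     else (sg x y, [y, x]) # map (\<lambda>(a, g). (a, [g])) (rbr x y))"

fun invs :: "rgen list \<Rightarrow> nat" where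
  "invs [] = 0"
| "invs (x # w) = size (filter_mset (\<lambda>y. key y < key x) (mset w)) + invs w"

text \<open>Inversions between the block and its context depend only on the multiset of letters of
  the block, so permuting the block affects only the inversions inside it.\<close>

lemma invs_middle:
  assumes "mset m' = mset m"
  shows "invs (u @ m' @ u') + invs m = invs (u @ m @ u') + invs m'"
proof -
  have *: "invs (m @ u') = invs m + invs u' + (\<Sum>x\<in>#mset m. size (filter_mset (\<lambda>y. key y < key x) (mset u')))" for m
    by (induction m) auto
  show ?thesis
  proof (induction u)
    case Nil
    show ?case using assms by (simp add: *)
  next
    case (Cons a u)
    then show ?case using assms by simp
  qed
qed

text \<open>The termination order: brackets and absorptions shorten a word, while the swap of a bad
  pair keeps the length and removes an inversion.\<close>

definition word_less :: "(rgen list \<times> rgen list) set" where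
  "word_less = measures [length, invs]"

lemma wf_word_less: "wf word_less"
  by (simp add: word_less_def)

lemma word_less_length: "length w < length w' \<Longrightarrow> (w, w') \<in> word_less"
  by (simp add: word_less_def)

lemma word_less_middle:
  assumes "mset m' = mset m" "invs m' < invs m"
  shows "(u @ m' @ u', u @ m @ u') \<in> word_less"
  using invs_middle[OF assms(1), of u u'] assms mset_eq_length[OF assms(1)]
  by (simp add: word_less_def)

lemma bad_rlist_less:
  assumes "bad x y" "(a, r) \<in> set (rlist x y)"
  shows "(u @ r @ u', u @ x # y # u') \<in> word_less"
proof -
  have "(u @ [y, x] @ u', u @ [x, y] @ u') \<in> word_less" if "x \<noteq> y"
    using assms(1) that by (intro word_less_middle) (auto simp: bad_def)
  then show ?thesis
    using assms by (auto simp: rlist_def word_less_length split: if_splits)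
qed

context cvector_space
begin

lemma lc_rlist: "lc scale (rlist x y) f =
    (if x = y then (1 / 2) *s lc scale (rbr x y) (\<lambda>g. f [g])
     else sg x y *s f [y, x] + lc scale (rbr x y) (\<lambda>g. f [g]))"
proof -
  have "lc scale (map (\<lambda>(a, g). (a, [g])) l) f = lc scale l (\<lambda>g. f [g])"
    and "lc scale (map (\<lambda>(a, g). (a / 2, [g])) l) f = (1 / 2) *s lc scale l (\<lambda>g. f [g])" for l
    by (induction l) (auto simp: scale_right_distrib)
  then show ?thesis by (simp add: rlist_def)
qed

lemma half_double: "(1 / 2) *s a + (1 / 2) *s a = a"
  using scale_left_distrib[of "1/2" "1/2" a] by simp

lemma half_of_double: "(1 / 2) *s (a + a) = a"
  by (simp only: scale_right_distrib half_double)

text \<open>The two ways of reversing \<open>x y z\<close>, starting with \<open>x y\<close> or with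
  \<open>y z\<close>. \<open>Z\<close> stands for \<open>z y x\<close>; \<open>A\<close>,
  \<open>B\<close>, \<open>C\<close> for \<open>[x,y] z\<close>, \<open>x [y,z]\<close>,
  \<open>y [x,z]\<close>, and the primed letters for the same products with the bracket on the other
  side. The results differ by the iterated brackets \<open>JA\<close>, \<open>JB\<close>,
  \<open>JC\<close>, which cancel by the Jacobi identity.\<close>

lemma overlap_arith:
  assumes J: "JB = JA + s1 *s JC"
    and L: "B = (s1 * s2) *s B' + JB" "A = (s2 * s3) *s A' + JA" "C = (s1 * s3) *s C' + JC"
    and s: "s1 \<in> {1, - 1}" "s2 \<in> {1, - 1}" "s3 \<in> {1, - 1}"
  shows "s1 *s (s2 *s (s3 *s Z + B') + C) + A = s3 *s (s2 *s (s1 *s Z + A') + C') + B"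
  unfolding L J using s by (auto simp: algebra_simps)

text \<open>The case \<open>x = y\<close>, with \<open>Z\<close> for \<open>z y y\<close>. The
  generic identity is used with 0 as the reversed word, and the square enters through
  \<open>z [y,y] = 2 z y y\<close>; the claim appears doubled.\<close>

lemma overlap_arith_12:
  assumes eq: "(- 1) *s (s *s (s *s 0 + B') + B) + A = s *s (s *s ((- 1) *s 0 + A') + B') + B" (is "?l = ?r")
    and A': "A' = Z + Z" and s: "s \<in> {1, - 1}"
  shows "(1 / 2) *s A = s *s (s *s Z + B') + B"
proof -
  let ?t = "s *s (s *s Z + B') + B"
  have "A - (?t + ?t) = ?l - ?r"
    using s unfolding A' by (auto simp: algebra_simps)
  then have "A = ?t + ?t" unfolding eq by simp
  then show ?thesis by (simp only: half_of_double)
qed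

text \<open>The mirror image for \<open>y = z\<close>, with \<open>Z\<close> for
  \<open>z z x\<close>.\<close>

lemma overlap_arith_23:
  assumes eq: "s *s (s *s ((- 1) *s 0 + B') + A') + A = (- 1) *s (s *s (s *s 0 + A') + A) + B" (is "?l = ?r")
    and B': "B' = Z + Z" and s: "s \<in> {1, - 1}"
  shows "s *s (s *s Z + A') + A = (1 / 2) *s B"
proof -
  let ?t = "s *s (s *s Z + A') + A"
  have "(?t + ?t) - B = ?l - ?r"
    using s unfolding B' by (auto simp: algebra_simps)
  then have "B = ?t + ?t" unfolding eq by simp
  then show ?thesis by (simp only: half_of_double)
qed

text \<open>For \<open>x = y = z\<close> the generic identity collapses to
  \<open>3 (P - Q) = 0\<close>, which expresses \<open>[x,[x,x]] = 0\<close>.\<close>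

lemma overlap_arith_123:
  assumes eq: "(- 1) *s ((- 1) *s ((- 1) *s 0 + P) + Q) + P = (- 1) *s ((- 1) *s ((- 1) *s 0 + Q) + P) + Q"
    (is "?l = ?r")
  shows "P = Q"
proof -
  have "3 *s X = X + X + X" for X
    using scale_left_distrib[of 1 2 X] scale_left_distrib[of 1 1 X] by (simp add: add.assoc)
  then have "3 *s (P - Q) = ?l - ?r"
    by (simp add: algebra_simps)
  then show ?thesis unfolding eq by simp
qed

text \<open>Think of \<open>k m\<close> as the normal form of a word in which \<open>m\<close>
  replaces the block \<open>x y z\<close>. The assumptions are reductions of smaller words:
  two-letter blocks are shorter, and the permuted blocks have fewer inversions once the letters
  exchanged are distinct, whence the guards.\<close>

lemma overlap_resolves:
  assumes xy: "bad x y" and yz: "bad y z"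
    and two: "\<And>p q. k [p, q] = sg p q *s k [q, p] + lc scale (rbr p q) (\<lambda>g. k [g])"
    and yxz: "x \<noteq> y \<Longrightarrow> k [y, x, z] = lc scale (rlist x z) (\<lambda>r. k (y # r))"
    and xzy: "y \<noteq> z \<Longrightarrow> k [x, z, y] = lc scale (rlist x z) (\<lambda>r. k (r @ [y]))"
    and yzx: "x \<noteq> z \<Longrightarrow> k [y, z, x] = lc scale (rlist y z) (\<lambda>r. k (r @ [x]))"
    and zxy: "x \<noteq> z \<Longrightarrow> k [z, x, y] = lc scale (rlist x y) (\<lambda>r. k (z # r))"
  shows "lc scale (rlist x y) (\<lambda>r. k (r @ [z])) = lc scale (rlist y z) (\<lambda>r. k (x # r))"
proof -
  have par: "sg p g = sg p q * sg p q'" "sg g p = sg q p * sg q' p"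
    if "(a, g) \<in> set (rbr q q')" for p q q' a g
    using rbr_odd[OF that] by (auto simp: sg_def)
  have left: "lc scale (rbr q q') (\<lambda>g. k [p, g]) = (sg p q * sg p q') *s lc scale (rbr q q') (\<lambda>g. k [g, p])
     + lc scale (rbr q q') (\<lambda>g. lc scale (rbr p g) (\<lambda>g. k [g]))" for p q q'
    unfolding lc_scale[symmetric] lc_add[symmetric]
    by (rule lc_cong) (metis two par(1))
  have right: "lc scale (rbr q q') (\<lambda>g. k [g, p]) = (sg q p * sg q' p) *s lc scale (rbr q q') (\<lambda>g. k [p, g])
     + lc scale (rbr q q') (\<lambda>g. lc scale (rbr g p) (\<lambda>g. k [g]))" for p q q'
    unfolding lc_scale[symmetric] lc_add[symmetric]
    by (rule lc_cong) (metis two par(2))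
  have sgyx: "sg y x = sg x y" by (simp add: sg_def)
  have arith: "sg x y *s (sg x z *s (sg y z *s Z + lc scale (rbr y z) (\<lambda>g. k [g, x]))
        + lc scale (rbr x z) (\<lambda>g. k [y, g])) + lc scale (rbr x y) (\<lambda>g. k [g, z])
     = sg y z *s (sg x z *s (sg x y *s Z + lc scale (rbr x y) (\<lambda>g. k [z, g]))
        + lc scale (rbr x z) (\<lambda>g. k [g, y])) + lc scale (rbr y z) (\<lambda>g. k [x, g])" for Z
    by (rule overlap_arith[OF rbr_jacobi[of y z x "\<lambda>g. k [g]"] left[of y z x]
          right[of x y z] left[of x z y, unfolded sgyx]])
      (simp_all add: sg_def)
  have xz: "x = z \<Longrightarrow> x = y \<and> y = z"
    using xy yz by (auto simp: bad_def)
  have odd: "odd_gen p" if "bad p p" for p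
    using that by (simp add: bad_def)
  have sg1: "sg p p = - 1" if "odd_gen p" for p
    using that by (simp add: sg_def)
  have sg2: "sg p q \<in> {1, - 1}" for p q
    by (simp add: sg_def)
  consider "x \<noteq> y" "y \<noteq> z" "x \<noteq> z" | "x = y" "y \<noteq> z" "odd_gen y" "x \<noteq> z" | "x \<noteq> y" "y = z" "odd_gen z" "x \<noteq> z"
    | "x = y" "y = z" "odd_gen z"
    using xy yz xz odd by blast
  then show ?thesis
  proof cases
    case 1
    then show ?thesis
      by (simp add: lc_rlist yxz xzy yzx zxy arith)
  next
    case 2
    have "lc scale (rbr y y) (\<lambda>g. k [z, g]) = k [z, y, y] + k [z, y, y]"
      using zxy 2 by (simp add: lc_rlist half_double)
    note overlap_arith_12[OF arith[of 0, unfolded 2(1) sg1[OF 2(3)]] this sg2]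
    moreover have "k [y, z, y] = sg y z *s k [z, y, y] + lc scale (rbr y z) (\<lambda>g. k [g, y])"
      using yzx 2 by (simp add: lc_rlist)
    ultimately show ?thesis
      using 2 by (simp add: lc_rlist)
  next
    case 3
    have "lc scale (rbr z z) (\<lambda>g. k [g, x]) = k [z, z, x] + k [z, z, x]"
      using yzx 3 by (simp add: lc_rlist half_double)
    note overlap_arith_23[OF arith[of 0, unfolded 3(2) sg1[OF 3(3)]] this sg2]
    moreover have "k [z, x, z] = sg x z *s k [z, z, x] + lc scale (rbr x z) (\<lambda>g. k [z, g])"
      using yxz 3 by (simp add: lc_rlist)
    ultimately show ?thesis
      using 3 by (simp add: lc_rlist)
  next
    case 4
    then show ?thesis
      using overlap_arith_123[OF arith[of 0, unfolded 4(1,2) sg1[OF 4(3)]]] by (simp add: lc_rlist)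
  qed
qed

end

subsection \<open>Normal forms of words\<close>

fun redex :: "rgen list \<Rightarrow> (rgen list \<times> rgen \<times> rgen \<times> rgen list) option" where
  "redex (x # y # w) = (if bad x y then Some ([], x, y, w) else map_option (map_prod (Cons x) id) (redex (y # w)))"
| "redex _ = None"

lemma redex_SomeD: "redex w = Some (u, x, y, u') \<Longrightarrow> w = u @ x # y # u' \<and> bad x y"
  by (induction w arbitrary: u rule: redex.induct) (auto split: if_splits)

text \<open>The Poincare-Birkhoff-Witt monomials of the part of negative degree: sorted words in
  which no odd letter is repeated.\<close>

definition normal :: "rgen list \<Rightarrow> bool" where
  "normal w \<longleftrightarrow> redex w = None \<and> (\<forall>x\<in>set w. \<not> in_b x)"

lemma redex_None_bad: "redex (u @ x # y # u') = None \<Longrightarrow> \<not> bad x y"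
proof (induction u)
  case (Cons a u)
  then show ?case by (cases u) (auto split: if_splits)
qed (auto split: if_splits)

lemma redex_None_key_le: "redex w = None \<Longrightarrow> x \<in> set w \<Longrightarrow> key x \<le> key (last w)"
proof (induction w arbitrary: x rule: redex.induct)
  case (1 a b w)
  then have "\<not> bad a b" "redex (b # w) = None" by (auto split: if_splits)
  moreover from this have "key y \<le> key (last (b # w))" if "y \<in> set (b # w)" for y
    using 1 that by simp
  ultimately show ?case using 1(3) by (force simp: bad_def)
qed auto

text \<open>Keys do not decrease along a word without a bad pair, so its last letter decides whether
  a letter of b occurs.\<close>

lemma redex_None_normal:
  assumes "redex w = None" "w = [] \<or> \<not> in_b (last w)"
  shows "normal w"
  using redex_None_key_le[OF assms(1)] assms unfolding normal_def in_b_iff_key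
  by (cases w) force+

context cvector_space
begin

text \<open>Rewriting is directed and halves squares; this recovers the undirected relation for an
  arbitrary pair. If only \<open>q p\<close> is bad, super antisymmetry turns its rule around; for
  an even \<open>p = q\<close> the bracket is its own negative, hence 0.\<close>

lemma rel_of_rlist:
  assumes pq: "bad p q \<Longrightarrow> k [p, q] = lc scale (rlist p q) k"
    and qp: "bad q p \<Longrightarrow> k [q, p] = lc scale (rlist q p) k"
  shows "k [p, q] = sg p q *s k [q, p] + lc scale (rbr p q) (\<lambda>g. k [g])"
proof (cases "p = q")
  case True
  show ?thesis
  proof (cases "odd_gen p")
    case odd: True
    then have "lc scale (rbr p q) (\<lambda>g. k [g]) = k [p, q] + k [p, q]"
      using pq True by (simp add: lc_rlist bad_def half_double)
    then show ?thesis using True odd by (simp add: sg_def)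
  next
    case False
    have "lc scale (rbr p p) (\<lambda>g. k [g]) = - lc scale (rbr p p) (\<lambda>g. k [g])"
      using lc_rbr_antisym[of p p] False by (simp add: sg_def)
    then have "lc scale (rbr p p) (\<lambda>g. k [g]) = 0"
      using half_of_double[of "lc scale (rbr p p) (\<lambda>g. k [g])"] by (metis add.left_inverse scale_zero_right)
    then show ?thesis using True False by (simp add: sg_def)
  qed
next
  case False
  then consider "bad p q" | "bad q p"
    using key_inject[of p q] by (force simp: bad_def)
  then show ?thesis
  proof cases
    case 1
    then show ?thesis using pq False by (simp add: lc_rlist)
  next
    case 2
    have "k [q, p] = sg p q *s k [p, q] + lc scale (rbr q p) (\<lambda>g. k [g])"
      using qp[OF 2] False by (auto simp add: lc_rlist sg_def)
    then show ?thesis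
      using lc_rbr_antisym[of p q "\<lambda>g. k [g]"]
      by (cases "odd_gen p \<and> odd_gen q") (auto simp: sg_def)
  qed
qed

end

lemma cvector_space_fscale: "cvector_space scale \<Longrightarrow> cvector_space (fscale scale)"
proof -
  assume "cvector_space scale"
  then interpret cvector_space scale .
  show ?thesis
    by unfold_locales (auto simp: fscale_def algebra_simps fun_eq_iff)
qed

section \<open>The normal form of a word applied to a vector, and confluence\<close>

locale b_rep =
  fixes scale :: "complex \<Rightarrow> 'v::ab_group_add \<Rightarrow> 'v" and V0 V1 :: "'v set"
    and act :: "rgen \<Rightarrow> 'v \<Rightarrow> 'v"
  assumes rep: "b_supermodule scale V0 V1 act"
begin

sublocale V: cvector_space scale
  using rep by (simp add: b_supermodule_def cvector_space_def)

sublocale F: cvector_space "fscale scale"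
  by (rule cvector_space_fscale) unfold_locales

lemma act_linear: "in_b x \<Longrightarrow> Vector_Spaces.linear scale scale (act x)"
  using rep by (simp add: b_supermodule_def)

lemma act_add: "in_b x \<Longrightarrow> act x (v + w) = act x v + act x w"
  using act_linear by (simp add: Vector_Spaces.linear_iff)

lemma act_scale: "in_b x \<Longrightarrow> act x (scale c v) = scale c (act x v)"
  using act_linear by (simp add: Vector_Spaces.linear_iff)

lemma act_zero: "in_b x \<Longrightarrow> act x 0 = 0"
  using act_add[of x 0 0] by simp

lemma act_rel:
  assumes "in_b x" "in_b y"
  shows "act x (act y v) = scale (sg x y) (act y (act x v)) + lc scale (rbr x y) (\<lambda>g. act g v)"
proof -
  have "(if odd_gen x \<and> odd_gen y then act x (act y v) + act y (act x v)
         else act x (act y v) - act y (act x v)) = lc scale (rbr x y) (\<lambda>g. act g v)"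
    using rep assms unfolding b_supermodule_def lc_def by blast
  then show ?thesis
    by (auto simp: sg_def algebra_simps split: if_splits)
qed

text \<open>A deterministic strategy, leftmost bad pair first and absorption only when no bad pair
  is left. This makes \<open>nf\<close> a function; that it respects the defining relations then
  amounts to confluence.\<close>

function nf :: "rgen list \<Rightarrow> 'v \<Rightarrow> rgen list \<Rightarrow> 'v" where
  "nf w v = (case redex w of
      Some (u, x, y, u') \<Rightarrow> (\<Sum>(a, r)\<leftarrow>rlist x y. fscale scale a (nf (u @ r @ u') v))
    | None \<Rightarrow> if w \<noteq> [] \<and> in_b (last w) then nf (butlast w) (act (last w) v) else single w v)"
  by auto
termination
  by (relation "inv_image word_less fst")
    (auto simp: wf_word_less word_less_length dest!: redex_SomeD intro: bad_rlist_less)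

declare nf.simps [simp del]

lemma nf_cases:
  obtains u x y u' where "w = u @ x # y # u'" "bad x y"
      "\<And>v. nf w v = lc (fscale scale) (rlist x y) (\<lambda>r. nf (u @ r @ u') v)"
  | u x where "redex w = None" "w = u @ [x]" "in_b x" "\<And>v. nf w v = nf u (act x v)"
  | "normal w" "\<And>v. nf w v = single w v"
proof (cases "redex w")
  case None
  show ?thesis
  proof (cases "w \<noteq> [] \<and> in_b (last w)")
    case True
    then show ?thesis
      using None that(2)[of "butlast w" "last w"] by (simp add: nf.simps[of w])
  next
    case False
    then show ?thesis
      using None that(3) redex_None_normal[OF None] False by (auto simp: nf.simps[of w])
  qed
next
  case (Some p)
  then obtain u x y u' where p: "redex w = Some (u, x, y, u')" by (cases p) auto
  have "nf w v = lc (fscale scale) (rlist x y) (\<lambda>r. nf (u @ r @ u') v)" for v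
    by (subst nf.simps) (simp add: p lc_def)
  then show ?thesis
    using that(1) redex_SomeD[OF p] by blast
qed

lemma nf_normal: "normal w \<Longrightarrow> nf w v = single w v"
  by (subst nf.simps) (auto simp: normal_def)

lemma single_add: "single w (v + v') = single w v + single w (v' :: 'v)"
  by (auto simp: single_def fun_eq_iff)

lemma single_scale: "single w (scale c v) = fscale scale c (single w v)"
  by (auto simp: single_def fscale_def fun_eq_iff)

lemma nf_add: "nf w (v + v') = nf w v + nf w v'"
proof (induction w arbitrary: v v' rule: wf_induct_rule[OF wf_word_less])
  case (1 w)
  show ?case
  proof (cases w rule: nf_cases)
    case (1 u x y u')
    have "nf (u @ r @ u') (v + v') = nf (u @ r @ u') v + nf (u @ r @ u') v'"
      if "(a, r) \<in> set (rlist x y)" for a r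
      using \<open>\<And>y v v'. (y, w) \<in> word_less \<Longrightarrow> nf y (v + v') = nf y v + nf y v'\<close> bad_rlist_less 1 that by blast
    then have "nf w (v + v') = lc (fscale scale) (rlist x y) (\<lambda>r. nf (u @ r @ u') v + nf (u @ r @ u') v')"
      unfolding 1(3) by (rule lc_cong)
    then show ?thesis by (simp add: F.lc_add 1(3))
  next
    case (2 u x)
    then show ?thesis using "1" by (simp add: act_add word_less_length)
  qed (simp add: single_add)
qed

lemma nf_scale: "nf w (scale c v) = fscale scale c (nf w v)"
proof (induction w arbitrary: v rule: wf_induct_rule[OF wf_word_less])
  case (1 w)
  show ?case
  proof (cases w rule: nf_cases)
    case (1 u x y u')
    have "nf (u @ r @ u') (scale c v) = fscale scale c (nf (u @ r @ u') v)"
      if "(a, r) \<in> set (rlist x y)" for a r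
      using \<open>\<And>y v. (y, w) \<in> word_less \<Longrightarrow> nf y (scale c v) = fscale scale c (nf y v)\<close> bad_rlist_less 1 that by blast
    then have "nf w (scale c v) = lc (fscale scale) (rlist x y) (\<lambda>r. fscale scale c (nf (u @ r @ u') v))"
      unfolding 1(3) by (rule lc_cong)
    then show ?thesis by (simp add: F.lc_scale 1(3))
  next
    case (2 u x)
    then show ?thesis using "1" by (simp add: act_scale word_less_length)
  qed (simp add: single_scale)
qed

lemma nf_zero: "nf w 0 = 0"
  using nf_add[of w 0 0] by simp

lemma nf_lc: "nf w (lc scale l f) = lc (fscale scale) l (\<lambda>g. nf w (f g))"
  by (induction l) (auto simp: nf_zero nf_add nf_scale)

text \<open>All reductions of a word lead to the same normal form, not only the leftmost one used by \<open>nf\<close>.\<close>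
definition redex_ok :: "rgen list \<Rightarrow> bool" where
  "redex_ok w \<longleftrightarrow> (\<forall>u x y u' v. w = u @ x # y # u' \<longrightarrow> bad x y \<longrightarrow>
     nf w v = lc (fscale scale) (rlist x y) (\<lambda>r. nf (u @ r @ u') v))"

definition absorb_ok :: "rgen list \<Rightarrow> bool" where
  "absorb_ok w \<longleftrightarrow> (\<forall>u x v. w = u @ [x] \<longrightarrow> in_b x \<longrightarrow> nf w v = nf u (act x v))"

lemma redex_okD:
  "redex_ok (u @ x # y # u') \<Longrightarrow> bad x y \<Longrightarrow>
     nf (u @ x # y # u') v = lc (fscale scale) (rlist x y) (\<lambda>r. nf (u @ r @ u') v)"
  by (auto simp: redex_ok_def)

lemma absorb_okD: "absorb_ok (u @ [x]) \<Longrightarrow> in_b x \<Longrightarrow> nf (u @ [x]) v = nf u (act x v)"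
  by (auto simp: absorb_ok_def)

text \<open>All words occurring in \<open>overlap_resolves\<close>, put into the context
  \<open>u\<close>, \<open>u'\<close>, lie below the given one, so the induction hypothesis provides
  its assumptions.\<close>

lemma confluent_overlap:
  assumes IH: "\<And>w'. (w', u @ [x, y, z] @ u') \<in> word_less \<Longrightarrow> redex_ok w'"
    and xy: "bad x y" and yz: "bad y z"
  shows "lc (fscale scale) (rlist x y) (\<lambda>r. nf (u @ r @ z # u') v)
       = lc (fscale scale) (rlist y z) (\<lambda>r. nf ((u @ [x]) @ r @ u') v)"
proof -
  let ?k = "\<lambda>m. nf (u @ m @ u') v"
  have len: "redex_ok (u @ [p, q] @ u')" for p q
    by (rule IH, rule word_less_length) simp
  have key: "key y \<le> key x" "key z \<le> key y" "x \<noteq> y \<longrightarrow> key y < key x" "y \<noteq> z \<longrightarrow> key z < key y"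
    using xy yz by (auto simp: bad_def)
  have three: "redex_ok (u @ m @ u')" if "mset m = {#x, y, z#}" "invs m < invs [x, y, z]" for m
    by (rule IH, rule word_less_middle) (use that in auto)
  have "lc (fscale scale) (rlist x y) (\<lambda>r. ?k (r @ [z])) = lc (fscale scale) (rlist y z) (\<lambda>r. ?k (x # r))"
  proof (rule F.overlap_resolves[OF xy yz])
    fix p q
    show "?k [p, q] = fscale scale (sg p q) (?k [q, p]) + lc (fscale scale) (rbr p q) (\<lambda>g. ?k [g])"
      using redex_okD[of u p q u'] redex_okD[of u q p u'] len[of p q] len[of q p]
      by (intro F.rel_of_rlist) auto
  next
    assume "x \<noteq> y"
    then show "?k [y, x, z] = lc (fscale scale) (rlist x z) (\<lambda>r. ?k (y # r))"
      using redex_okD[of "u @ [y]" x z u' v] three[of "[y, x, z]"] key by (auto simp: bad_def)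
  next
    assume "y \<noteq> z"
    then show "?k [x, z, y] = lc (fscale scale) (rlist x z) (\<lambda>r. ?k (r @ [y]))"
      using redex_okD[of u x z "y # u'" v] three[of "[x, z, y]"] key by (auto simp: bad_def)
  next
    assume "x \<noteq> z"
    then show "?k [y, z, x] = lc (fscale scale) (rlist y z) (\<lambda>r. ?k (r @ [x]))"
      using redex_okD[of u y z "x # u'" v] three[of "[y, z, x]"] key yz by (auto simp: bad_def)
  next
    assume "x \<noteq> z"
    then show "?k [z, x, y] = lc (fscale scale) (rlist x y) (\<lambda>r. ?k (z # r))"
      using redex_okD[of "u @ [z]" x y u' v] three[of "[z, x, y]"] key xy by (auto simp: bad_def)
  qed
  then show ?thesis by simp
qed

text \<open>Both sides equal the double sum in which both pairs have been reduced; either order of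
  summation is reached from words below the given one.\<close>

lemma confluent_disjoint:
  assumes IH: "\<And>w'. (w', u @ x # y # m @ p # q # u') \<in> word_less \<Longrightarrow> redex_ok w'"
    and xy: "bad x y" and pq: "bad p q"
  shows "lc (fscale scale) (rlist x y) (\<lambda>r. nf (u @ r @ m @ p # q # u') v)
       = lc (fscale scale) (rlist p q) (\<lambda>r. nf ((u @ x # y # m) @ r @ u') v)"
proof -
  have "nf (u @ r @ m @ p # q # u') v
      = lc (fscale scale) (rlist p q) (\<lambda>r'. nf (u @ r @ m @ r' @ u') v)"
    if "(a, r) \<in> set (rlist x y)" for a r
    using redex_okD[OF _ pq, of "u @ r @ m" u' v] IH[OF bad_rlist_less[OF xy that]] by simp
  then have "lc (fscale scale) (rlist x y) (\<lambda>r. nf (u @ r @ m @ p # q # u') v)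
    = lc (fscale scale) (rlist x y) (\<lambda>r. lc (fscale scale) (rlist p q) (\<lambda>r'. nf (u @ r @ m @ r' @ u') v))"
    by (rule lc_cong)
  also have "\<dots> = lc (fscale scale) (rlist p q) (\<lambda>r'. lc (fscale scale) (rlist x y) (\<lambda>r. nf (u @ r @ m @ r' @ u') v))"
    by (rule F.lc_swap)
  also have "\<dots> = lc (fscale scale) (rlist p q) (\<lambda>r. nf ((u @ x # y # m) @ r @ u') v)"
  proof (rule lc_cong)
    fix a r assume "(a, r) \<in> set (rlist p q)"
    from bad_rlist_less[OF pq this, of "u @ x # y # m" u']
    show "lc (fscale scale) (rlist x y) (\<lambda>r'. nf (u @ r' @ m @ r @ u') v) = nf ((u @ x # y # m) @ r @ u') v"
      using redex_okD[OF _ xy, of u "m @ r @ u'" v] IH by simp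
  qed
  finally show ?thesis .
qed

lemma confluent_less:
  assumes IH: "\<And>w'. (w', w) \<in> word_less \<Longrightarrow> redex_ok w'"
    and w: "w = u @ x # y # u'" "w = A @ p # q # B" and bad: "bad x y" "bad p q"
    and len: "length u < length A"
  shows "lc (fscale scale) (rlist x y) (\<lambda>r. nf (u @ r @ u') v)
       = lc (fscale scale) (rlist p q) (\<lambda>r. nf (A @ r @ B) v)"
proof -
  from w len obtain us where us: "A = u @ us" "us \<noteq> []" "x # y # u' = us @ p # q # B"
    by (auto simp: append_eq_append_conv2)
  then obtain m where m: "A = u @ x # m" "y # u' = m @ p # q # B"
    by (cases us) auto
  show ?thesis
  \<comment> \<open>If the gap \<open>m\<close> is empty, the pairs share the letter
    \<open>y = p\<close> and overlap; otherwise they are disjoint.\<close>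
  proof (cases m)
    case Nil
    then show ?thesis
      using confluent_overlap[of u x y q B v] IH m w bad by simp
  next
    case (Cons y' m')
    then show ?thesis
      using confluent_disjoint[of u x y m' p q B v] IH m w bad by simp
  qed
qed

text \<open>With \<open>y\<close> in b and the pair bad, \<open>x\<close> is in b as well, having a
  key at least as large. So the swapped pair and the bracket can all be absorbed, and the claim
  becomes the module law of V, halved when \<open>x = y\<close> is odd.\<close>

lemma absorb_at_end:
  assumes IH: "\<And>w'. (w', u @ [x, y]) \<in> word_less \<Longrightarrow> absorb_ok w'"
    and xy: "bad x y" and y: "in_b y"
  shows "lc (fscale scale) (rlist x y) (\<lambda>r. nf (u @ r) v) = nf (u @ [x]) (act y v)"
proof -
  have x: "in_b x" using xy y by (auto simp: bad_def in_b_iff_key)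
  have one: "nf (u @ [g]) v' = nf u (act g v')" if "in_b g" for g v'
    using IH[of "u @ [g]"] that absorb_okD by (simp add: word_less_length)
  have "lc (fscale scale) (rbr x y) (\<lambda>g. nf (u @ [g]) v) = lc (fscale scale) (rbr x y) (\<lambda>g. nf u (act g v))"
    by (rule lc_cong) (use one rbr_in_b x y in blast)
  then have br: "lc (fscale scale) (rbr x y) (\<lambda>g. nf (u @ [g]) v) = nf u (lc scale (rbr x y) (\<lambda>g. act g v))"
    by (simp add: nf_lc)
  have rel: "nf u (act x (act y v)) = fscale scale (sg x y) (nf u (act y (act x v)))
      + nf u (lc scale (rbr x y) (\<lambda>g. act g v))"
    by (subst act_rel[OF x y]) (simp add: nf_add nf_scale)
  show ?thesis
  proof (cases "x = y")
    case True
    then have "odd_gen y" using xy by (simp add: bad_def)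
    then have "lc (fscale scale) (rbr x y) (\<lambda>g. nf (u @ [g]) v) = nf u (act x (act y v)) + nf u (act x (act y v))"
      using rel True unfolding br by (simp add: sg_def) (metis diff_add_cancel)
    then show ?thesis using True by (simp add: F.lc_rlist F.half_of_double one[OF y])
  next
    case False
    have "(u @ [y, x], u @ [x, y]) \<in> word_less"
      using word_less_middle[of "[y, x]" "[x, y]" u "[]"] xy False by (auto simp: bad_def)
    then have "nf (u @ [y, x]) v = nf u (act y (act x v))"
      using absorb_okD[OF _ x, of "u @ [y]" v] IH one[OF y] by simp
    then show ?thesis using False rel br by (simp add: F.lc_rlist one[OF x])
  qed
qed

text \<open>Induction along \<open>word_less\<close>, comparing any other reduction of
  \<open>w\<close> with the one chosen by \<open>nf\<close>.\<close>

lemma nf_ok: "redex_ok w \<and> absorb_ok w"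
proof (induction w rule: wf_induct_rule[OF wf_word_less])
  case (1 w)
  then have IHr: "\<And>w'. (w', w) \<in> word_less \<Longrightarrow> redex_ok w'"
    and IHa: "\<And>w'. (w', w) \<in> word_less \<Longrightarrow> absorb_ok w'" by auto
  show ?case
  proof (cases w rule: nf_cases)
    case (1 u x y u')
    have "nf w v = lc (fscale scale) (rlist p q) (\<lambda>r. nf (A @ r @ B) v)"
      if w: "w = A @ p # q # B" and pq: "bad p q" for A p q B v
    proof (cases "length u" "length A" rule: linorder_cases)
      case less
      then show ?thesis using confluent_less[OF IHr 1(1) w 1(2) pq] 1(3) by simp
    next
      case equal
      then show ?thesis using w 1 by auto
    next
      case greater
      then show ?thesis using confluent_less[OF IHr w 1(1) pq 1(2)] 1(3) by simp
    qed
    \<comment> \<open>An absorption competing with the leftmost bad pair. If that pair contains the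
      last letter, this is \<open>absorb_at_end\<close>; otherwise the two steps take place at
      disjoint positions and commute.\<close>
    moreover have "nf w v = nf A (act z v)" if w: "w = A @ [z]" and z: "in_b z" for A z v
    proof (cases u' rule: rev_cases)
      case Nil
      then show ?thesis using absorb_at_end[of u x y v] IHa 1 w z by auto
    next
      case (snoc B z')
      then have A: "A = u @ x # y # B" "z' = z" using 1(1) w by auto
      have "nf (u @ r @ u') v = nf (u @ r @ B) (act z v)" if "(a, r) \<in> set (rlist x y)" for a r
        using absorb_okD[OF _ z, of "u @ r @ B" v] IHa bad_rlist_less[OF 1(2) that, of u u'] 1(1) snoc A by simp
      then have "nf w v = lc (fscale scale) (rlist x y) (\<lambda>r. nf (u @ r @ B) (act z v))"
        unfolding 1(3) by (rule lc_cong)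
      also have "\<dots> = nf A (act z v)"
        using redex_okD[OF _ 1(2), of u B "act z v"] IHr[of A] w A by (simp add: word_less_length)
      finally show ?thesis .
    qed
    ultimately show ?thesis unfolding redex_ok_def absorb_ok_def by blast
  next
    case (2 u x)
    then show ?thesis
      using redex_None_bad by (auto simp: redex_ok_def absorb_ok_def)
  next
    case 3
    then show ?thesis
      using redex_None_bad by (fastforce simp: redex_ok_def absorb_ok_def normal_def)
  qed
qed

lemma nf_rel:
  "nf (u @ [x, y] @ u') v = fscale scale (sg x y) (nf (u @ [y, x] @ u') v)
     + lc (fscale scale) (rbr x y) (\<lambda>g. nf (u @ [g] @ u') v)"
  using redex_okD[of u x y u'] redex_okD[of u y x u'] nf_ok
  by (intro F.rel_of_rlist[where k = "\<lambda>m. nf (u @ m @ u') v"]) auto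

lemma nf_absorb: "in_b x \<Longrightarrow> nf (u @ [x]) v = nf u (act x v)"
  using absorb_okD nf_ok by blast

end

subsection \<open>The kernel of the projection to the induced module\<close>

lemma diff_add_diff: "a - b + (b - c) = a - (c :: 'a::ab_group_add)"
  by simp

context cvector_space
begin

text \<open>Terms with coefficient 0 are exempt because \<open>rbr\<close> lists \<open>c\<close>
  even where its coefficient vanishes, and there \<open>c\<close> has the wrong degree.\<close>

lemma lc_mem:
  "subspace S \<Longrightarrow> (\<And>a g. (a, g) \<in> set l \<Longrightarrow> a \<noteq> 0 \<Longrightarrow> f g \<in> S) \<Longrightarrow> lc scale l f \<in> S"
proof (induction l)
  case Nil
  then show ?case by (simp add: subspace_0)
next
  case (Cons p l)
  obtain a g where p: "p = (a, g)" by (cases p)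
  have "a *s f g \<in> S"
    using Cons.prems(2)[of a g] p by (cases "a = 0") (auto simp: subspace_0 subspace_scale Cons.prems(1))
  moreover have "lc scale l f \<in> S"
    using Cons by auto
  ultimately show ?case
    using p Cons.prems(1) by (simp add: subspace_add)
qed

lemma span_induct_subspace: "x \<in> span A \<Longrightarrow> subspace S \<Longrightarrow> A \<subseteq> S \<Longrightarrow> x \<in> S"
  using span_minimal by blast

end

lemma lact_add: "lact x (f + g) = lact x f + lact x (g :: _ \<Rightarrow> 'a::monoid_add)"
  by (auto simp: lact_def fun_eq_iff split: list.split)

lemma lact_diff: "lact x (f - g) = lact x f - lact x (g :: _ \<Rightarrow> 'a::group_add)"
  by (auto simp: lact_def fun_eq_iff split: list.split)

lemma lact_uminus: "lact x (- f) = - lact x (f :: _ \<Rightarrow> 'a::group_add)"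
  by (auto simp: lact_def fun_eq_iff split: list.split)

lemma lact_zero: "lact x (0 :: _ \<Rightarrow> 'a::zero) = 0"
  by (auto simp: lact_def fun_eq_iff split: list.split)

lemma lact_single: "lact x (single w v) = single (x # w) v"
  by (auto simp: lact_def single_def fun_eq_iff split: list.split)

lemma single_apply: "single w v u = (if u = w then v else 0)"
  by (simp add: single_def)

lemma single_eq_0_iff: "single w v = 0 \<longleftrightarrow> v = 0"
  by (auto simp: single_def fun_eq_iff)

context b_rep
begin

abbreviation K :: "(rgen list \<Rightarrow> 'v) set" where
  "K \<equiv> indK scale act"

lemma lact_scale: "lact x (fscale scale a f) = fscale scale a (lact x f)"
  by (auto simp: lact_def fscale_def fun_eq_iff split: list.split)

lemma lact_lc: "lact x (lc (fscale scale) l f) = lc (fscale scale) l (\<lambda>g. lact x (f g))"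
proof (induction l)
  case Nil
  show ?case by (simp only: lc_Nil lact_zero)
next
  case (Cons p l)
  then show ?case by (cases p) (simp only: lc_Cons lact_add lact_scale)
qed

lemma lact_preimage_subspace: "F.subspace S \<Longrightarrow> F.subspace {f. lact x f \<in> S}"
  by (auto simp: F.subspace_def lact_add lact_scale lact_zero)

lemma subspace_support: "F.subspace {f \<in> indF. \<forall>w. f w \<noteq> 0 \<longrightarrow> P w}" (is "F.subspace ?S")
proof (rule F.subspaceI)
  show "0 \<in> ?S" by (simp add: indF_def)
next
  fix f g assume fg: "f \<in> ?S" "g \<in> ?S"
  have sub: "{w. (f + g) w \<noteq> 0} \<subseteq> {w. f w \<noteq> 0} \<union> {w. g w \<noteq> 0}" by auto
  moreover have "finite {w. (f + g) w \<noteq> 0}"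
    using fg by (intro finite_subset[OF sub]) (simp add: indF_def)
  ultimately show "f + g \<in> ?S"
    using fg unfolding indF_def by blast
next
  fix c f assume f: "f \<in> ?S"
  have sub: "{w. fscale scale c f w \<noteq> 0} \<subseteq> {w. f w \<noteq> 0}" by (auto simp: fscale_def)
  moreover have "finite {w. fscale scale c f w \<noteq> 0}"
    using f by (intro finite_subset[OF sub]) (simp add: indF_def)
  ultimately show "fscale scale c f \<in> ?S"
    using f unfolding indF_def by blast
qed

lemma subspace_indF: "F.subspace indF"
  using subspace_support[of "\<lambda>_. True"] by simp

lemma single_indF: "single w v \<in> indF"
  by (auto simp: indF_def single_def)

lemma indF_mem_subspace:
  assumes f: "f \<in> indF" and S: "F.subspace S" and s: "\<And>w. f w \<noteq> 0 \<Longrightarrow> single w (f w) \<in> S"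
  shows "f \<in> S"
proof -
  let ?A = "{w. f w \<noteq> 0}"
  have fin: "finite ?A" using f by (simp add: indF_def)
  have "(\<Sum>w\<in>?A. single w (f w)) = f"
  proof
    fix u
    have "(\<Sum>w\<in>?A. single w (f w)) u = (\<Sum>w\<in>?A. single w (f w) u)"
      using fin by (induction rule: finite_induct) auto
    also have "\<dots> = (\<Sum>w\<in>?A. if u = w then f w else 0)"
      by (simp add: single_def)
    also have "\<dots> = f u" using fin by simp
    finally show "(\<Sum>w\<in>?A. single w (f w)) u = f u" .
  qed
  then show ?thesis
    using F.subspace_sum[OF S, of ?A "\<lambda>w. single w (f w)"] s by auto
qed

lemma K_subspace: "F.subspace K"
  unfolding indK_def by (rule F.subspace_span)

text \<open>The relations admit any left context \<open>u\<close>, so a letter put in front of a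
  relation yields a relation of the same kind.\<close>

lemma lact_K: "f \<in> K \<Longrightarrow> lact x f \<in> K"
  unfolding indK_def
proof (rule F.span_induct_subspace[where S = "{f. lact x f \<in> F.span (ind_rels scale act)}", simplified])
  show "F.subspace {f. lact x f \<in> F.span (ind_rels scale act)}"
    by (intro lact_preimage_subspace F.subspace_span)
  show "ind_rels scale act \<subseteq> {f. lact x f \<in> F.span (ind_rels scale act)}"
  proof
    fix f assume "f \<in> ind_rels scale act"
    then have "lact x f \<in> ind_rels scale act"
    proof (cases rule: UnE[OF \<open>f \<in> ind_rels scale act\<close>[unfolded ind_rels_def]])
      case 1
      then obtain u y z u' v where f: "f = single (u @ [y, z] @ u') v
        - (if odd_gen y \<and> odd_gen z then - single (u @ [z, y] @ u') v
           else single (u @ [z, y] @ u') v)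
        - lc (fscale scale) (rbr y z) (\<lambda>g. single (u @ [g] @ u') v)"
        unfolding lc_def by blast
      have "lact x f = single ((x # u) @ [y, z] @ u') v
        - (if odd_gen y \<and> odd_gen z then - single ((x # u) @ [z, y] @ u') v
           else single ((x # u) @ [z, y] @ u') v)
        - lc (fscale scale) (rbr y z) (\<lambda>g. single ((x # u) @ [g] @ u') v)"
        unfolding f by (simp add: lact_diff lact_uminus lact_single lact_lc)
      then show ?thesis unfolding ind_rels_def lc_def by blast
    next
      case 2
      then obtain u y v where "f = single (u @ [y]) v - single u (act y v)" "in_b y" by blast
      then have "lact x f = single ((x # u) @ [y]) v - single (x # u) (act y v)" "in_b y"
        by (simp_all add: lact_diff lact_single)
      then show ?thesis unfolding ind_rels_def by blast
    qed
    then show "f \<in> {f. lact x f \<in> F.span (ind_rels scale act)}"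
      by (auto intro: F.span_base)
  qed
qed

lemma K_rel:
  "single (u @ [x, y] @ u') v - (fscale scale (sg x y) (single (u @ [y, x] @ u') v)
     + lc (fscale scale) (rbr x y) (\<lambda>g. single (u @ [g] @ u') v)) \<in> K"
proof -
  have "single (u @ [x, y] @ u') v
        - (if odd_gen x \<and> odd_gen y then - single (u @ [y, x] @ u') v
           else single (u @ [y, x] @ u') v)
        - lc (fscale scale) (rbr x y) (\<lambda>g. single (u @ [g] @ u') v) \<in> K"
    unfolding indK_def ind_rels_def lc_def by (intro F.span_base) blast
  then show ?thesis
    by (cases "odd_gen x \<and> odd_gen y") (auto simp: sg_def diff_diff_eq diff_diff_eq2)
qed

lemma K_absorb: "in_b x \<Longrightarrow> single (u @ [x]) v - single u (act x v) \<in> K"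
  unfolding indK_def ind_rels_def by (intro F.span_base) blast

section \<open>The linear extension of the normal form and its kernel\<close>

definition NF :: "(rgen list \<Rightarrow> 'v) \<Rightarrow> rgen list \<Rightarrow> 'v" where
  "NF f = (\<Sum>w | f w \<noteq> 0. nf w (f w))"

lemma NF_superset: "finite S \<Longrightarrow> {w. f w \<noteq> 0} \<subseteq> S \<Longrightarrow> NF f = (\<Sum>w\<in>S. nf w (f w))"
  unfolding NF_def by (intro sum.mono_neutral_left) (auto simp: nf_zero)

lemma NF_add:
  assumes "f \<in> indF" "g \<in> indF"
  shows "NF (f + g) = NF f + NF g"
proof -
  let ?S = "{w. f w \<noteq> 0} \<union> {w. g w \<noteq> 0}"
  have fin: "finite ?S" using assms by (simp add: indF_def)
  have "{w. (f + g) w \<noteq> 0} \<subseteq> ?S" by auto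
  then show ?thesis
    using NF_superset[OF fin, of "f + g"] NF_superset[OF fin, of f] NF_superset[OF fin, of g]
    by (auto simp: nf_add sum.distrib)
qed

lemma NF_scale:
  assumes "f \<in> indF"
  shows "NF (fscale scale c f) = fscale scale c (NF f)"
proof -
  let ?S = "{w. f w \<noteq> 0}"
  have fin: "finite ?S" using assms by (simp add: indF_def)
  have "NF (fscale scale c f) = (\<Sum>w\<in>?S. nf w (fscale scale c f w))"
    by (rule NF_superset[OF fin]) (auto simp: fscale_def)
  then show ?thesis
    by (simp add: NF_def fscale_def[of scale c f] nf_scale F.scale_sum_right)
qed

lemma NF_single: "NF (single w v) = nf w v"
  by (subst NF_superset[of "{w}"]) (auto simp: single_apply split: if_splits)

lemma NF_preimage_subspace: "F.subspace S \<Longrightarrow> F.subspace {f \<in> indF. NF f \<in> S}"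
  using subspace_indF NF_superset[of "{}" 0]
  by (auto simp: F.subspace_def NF_add NF_scale)

lemma NF_diff: "f \<in> indF \<Longrightarrow> g \<in> indF \<Longrightarrow> NF (f - g) = NF f - NF g"
  using NF_add[of "f - g" g] F.subspace_diff[OF subspace_indF] by simp

lemma NF_lc: "(\<And>g. f g \<in> indF) \<Longrightarrow> lc (fscale scale) l f \<in> indF \<and> NF (lc (fscale scale) l f) = lc (fscale scale) l (\<lambda>g. NF (f g))"
  using NF_superset[of "{}" 0] subspace_indF
  by (induction l) (auto simp: F.subspace_def NF_add NF_scale)

text \<open>The independence half of the Poincare-Birkhoff-Witt theorem: by confluence
  \<open>NF\<close> kills every relation, while it fixes normal words, so no nonzero combination of
  normal words lies in \<open>K\<close>.\<close>

lemma K_NF: "f \<in> K \<Longrightarrow> f \<in> indF \<and> NF f = 0"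
proof -
  assume f: "f \<in> K"
  have "ind_rels scale act \<subseteq> {f \<in> indF. NF f \<in> {0}}"
  proof
    fix f assume "f \<in> ind_rels scale act"
    then show "f \<in> {f \<in> indF. NF f \<in> {0}}"
    proof (cases rule: UnE[OF \<open>f \<in> ind_rels scale act\<close>[unfolded ind_rels_def]])
      case 1
      then obtain u x y u' v where "f = single (u @ [x, y] @ u') v
        - (if odd_gen x \<and> odd_gen y then - single (u @ [y, x] @ u') v
           else single (u @ [y, x] @ u') v)
        - lc (fscale scale) (rbr x y) (\<lambda>g. single (u @ [g] @ u') v)"
        unfolding lc_def by blast
      then have f: "f = single (u @ [x, y] @ u') v - fscale scale (sg x y) (single (u @ [y, x] @ u') v)
        - lc (fscale scale) (rbr x y) (\<lambda>g. single (u @ [g] @ u') v)"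
        by (auto simp: sg_def)
      note NF_lc[of "\<lambda>g. single (u @ [g] @ u') v" "rbr x y", OF single_indF]
      then show ?thesis
        unfolding f using nf_rel[of u x y u' v]
        by (simp add: NF_diff NF_scale NF_single single_indF F.subspace_diff[OF subspace_indF]
            F.subspace_scale[OF subspace_indF])
    next
      case 2
      then obtain u y v where "f = single (u @ [y]) v - single u (act y v)" "in_b y" by blast
      then show ?thesis
        by (simp add: NF_diff NF_single single_indF nf_absorb F.subspace_diff[OF subspace_indF])
    qed
  qed
  from F.span_induct_subspace[OF f[unfolded indK_def] NF_preimage_subspace[OF F.subspace_single_0] this]
  show ?thesis by simp
qed

text \<open>The spanning half: each rewriting step changes the word by an element of
  \<open>K\<close>.\<close>

lemma single_nf_K: "single w v - nf w v \<in> K"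
proof (induction w arbitrary: v rule: wf_induct_rule[OF wf_word_less])
  case (1 w)
  note IH = this
  show ?case
  proof (cases w rule: nf_cases)
    case (1 u x y u')
    have "lc (fscale scale) (rlist x y) (\<lambda>r. single (u @ r @ u') v + fscale scale (- 1) (nf (u @ r @ u') v)) \<in> K"
    proof (rule F.lc_mem[OF K_subspace])
      fix a r assume "(a, r) \<in> set (rlist x y)"
      then have "single (u @ r @ u') v - nf (u @ r @ u') v \<in> K"
        using IH[of "u @ r @ u'" v] bad_rlist_less[OF 1(2)] 1(1) by blast
      then show "single (u @ r @ u') v + fscale scale (- 1) (nf (u @ r @ u') v) \<in> K" by simp
    qed
    then have a: "lc (fscale scale) (rlist x y) (\<lambda>r. single (u @ r @ u') v) - nf w v \<in> K"
      unfolding F.lc_add F.lc_scale 1(3) by simp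
    have "single w v - lc (fscale scale) (rlist x y) (\<lambda>r. single (u @ r @ u') v) \<in> K"
    proof (cases "x = y")
      case True
      then have "odd_gen x" using 1(2) by (simp add: bad_def)
      \<comment> \<open>For an odd letter the relation reads \<open>x x + x x = [x,x]\<close>, so it
        has to be halved.\<close>
      then have "single w v + single w v - lc (fscale scale) (rbr x y) (\<lambda>g. single (u @ [g] @ u') v) \<in> K"
        using K_rel[of u x y u' v] True 1(1) by (simp add: sg_def diff_diff_eq2)
      then have "fscale scale (1/2) (single w v + single w v - lc (fscale scale) (rbr x y) (\<lambda>g. single (u @ [g] @ u') v)) \<in> K"
        by (rule F.subspace_scale[OF K_subspace])
      then show ?thesis
        using True by (simp add: F.lc_rlist F.scale_right_diff_distrib F.half_of_double)
    next
      case False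
      then show ?thesis
        using K_rel[of u x y u' v] 1(1) by (simp add: F.lc_rlist)
    qed
    from F.subspace_add[OF K_subspace this a] show ?thesis by (simp only: diff_add_diff)
  next
    case (2 u x)
    have "single u (act x v) - nf u (act x v) \<in> K"
      by (rule IH) (simp add: 2(2) word_less_length)
    from F.subspace_add[OF K_subspace K_absorb[OF 2(3), of u v] this]
    have "single w v - nf u (act x v) \<in> K"
      using 2(2) by simp
    then show ?thesis unfolding 2(4) .
  next
    case 3
    then show ?thesis by (simp only: diff_self F.subspace_0[OF K_subspace])
  qed
qed

text \<open>An induction principle for \<open>nf\<close>: an invariant \<open>P\<close> of word and
  vector need only survive single reductions and absorptions. It serves for normality and for
  parity.\<close>

lemma nf_mem:
  assumes S: "F.subspace S"
    and red: "\<And>u x y u' a r v. P (u @ x # y # u') v \<Longrightarrow> bad x y \<Longrightarrow> (a, r) \<in> set (rlist x y) \<Longrightarrow> P (u @ r @ u') v"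
    and abs: "\<And>u x v. P (u @ [x]) v \<Longrightarrow> in_b x \<Longrightarrow> P u (act x v)"
    and normal: "\<And>w v. P w v \<Longrightarrow> normal w \<Longrightarrow> single w v \<in> S"
  shows "P w v \<Longrightarrow> nf w v \<in> S"
proof (induction w arbitrary: v rule: wf_induct_rule[OF wf_word_less])
  case (1 w)
  note IH = this
  show ?case
  proof (cases w rule: nf_cases)
    case (1 u x y u')
    show ?thesis
      unfolding 1(3)
      using IH bad_rlist_less[OF 1(2)] 1(1,2) red by (intro F.lc_mem[OF S]) blast
  next
    case (2 u x)
    then show ?thesis using IH(1)[of u "act x v"] IH(2) abs by (simp add: word_less_length)
  next
    case 3
    then show ?thesis using normal IH by simp
  qed
qed

definition N :: "(rgen list \<Rightarrow> 'v) set" where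
  "N = {f \<in> indF. \<forall>w. f w \<noteq> 0 \<longrightarrow> normal w}"

lemma N_subspace: "F.subspace N"
  unfolding N_def by (rule subspace_support)

lemma nf_N: "nf w v \<in> N"
  by (rule nf_mem[where P = "\<lambda>_ _. True", OF N_subspace])
    (auto simp: N_def single_indF, simp add: single_def split: if_splits)

lemma indF_NF:
  assumes "f \<in> indF"
  shows "f - NF f \<in> K" and "NF f \<in> N"
proof -
  let ?S = "{f \<in> indF. f - NF f \<in> K}"
  have "F.subspace ?S"
  proof (rule F.subspaceI)
    show "0 \<in> ?S"
      using F.subspace_0[OF subspace_indF] F.subspace_0[OF K_subspace] NF_superset[of "{}" 0] by simp
  next
    fix f g assume *: "f \<in> ?S" "g \<in> ?S"
    then have "f - NF f + (g - NF g) \<in> K" by (auto intro: F.subspace_add[OF K_subspace])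
    then have "f + g - NF (f + g) \<in> K" using * by (simp only: mem_Collect_eq NF_add add_diff_add)
    then show "f + g \<in> ?S"
      using * F.subspace_add[OF subspace_indF, of f g] by blast
  next
    fix c f assume *: "f \<in> ?S"
    then have "fscale scale c (f - NF f) \<in> K" by (auto intro: F.subspace_scale[OF K_subspace])
    then have "fscale scale c f - NF (fscale scale c f) \<in> K"
      using * by (simp only: mem_Collect_eq NF_scale F.scale_right_diff_distrib)
    then show "fscale scale c f \<in> ?S"
      using * F.subspace_scale[OF subspace_indF, of f c] by blast
  qed
  from indF_mem_subspace[OF assms this] show "f - NF f \<in> K"
    using single_nf_K by (auto simp: NF_single single_indF)
  show "NF f \<in> N"
    using indF_mem_subspace[OF assms NF_preimage_subspace[OF N_subspace]]
    by (auto simp: NF_single single_indF nf_N)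
qed

section \<open>Parity of normal forms\<close>

lemma V_subspace: "V.subspace V0" "V.subspace V1"
  using rep by (auto simp: b_supermodule_def)

lemma word_odd_append: "word_odd (u @ w) \<longleftrightarrow> word_odd u \<noteq> word_odd w"
  by (simp add: word_odd_def)

lemma word_odd_simps [simp]: "\<not> word_odd []" "word_odd (x # w) \<longleftrightarrow> odd_gen x \<noteq> word_odd w"
  by (simp_all add: word_odd_def)

lemma indF_par_subspace: "F.subspace (indF_par V0 V1 p)"
  using subspace_indF V_subspace unfolding F.subspace_def V.subspace_def indF_par_def
  by (auto simp: fscale_def)

lemma rlist_odd:
  "(a, r) \<in> set (rlist x y) \<Longrightarrow> word_odd r \<longleftrightarrow> odd_gen x \<noteq> odd_gen y"
  by (auto simp: rlist_def dest!: rbr_odd split: if_splits)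

text \<open>The invariant is the parity of the word plus that of the vector; an absorption moves the
  parity of \<open>x\<close> from the word to the vector.\<close>

lemma nf_par:
  assumes "v \<in> (if word_odd w = p then V0 else V1)"
  shows "nf w v \<in> indF_par V0 V1 p"
proof (rule nf_mem[where P = "\<lambda>w v. v \<in> (if word_odd w = p then V0 else V1)", OF indF_par_subspace _ _ _ assms])
  fix u x y u' a r v
  assume v: "v \<in> (if word_odd (u @ x # y # u') = p then V0 else V1)" and r: "(a, r) \<in> set (rlist x y)"
  then show "v \<in> (if word_odd (u @ r @ u') = p then V0 else V1)"
    using v rlist_odd[OF r] by (auto simp: word_odd_append split: if_splits)
next
  fix u x v
  assume v: "v \<in> (if word_odd (u @ [x]) = p then V0 else V1)" and x: "in_b x"
  have "if odd_gen x then act x ` V0 \<subseteq> V1 \<and> act x ` V1 \<subseteq> V0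
         else act x ` V0 \<subseteq> V0 \<and> act x ` V1 \<subseteq> V1"
    using rep x unfolding b_supermodule_def by blast
  then show "act x v \<in> (if word_odd u = p then V0 else V1)"
    using v by (auto simp: word_odd_append split: if_splits)
next
  fix w v assume "v \<in> (if word_odd w = p then V0 else V1)"
  then show "single w v \<in> indF_par V0 V1 p"
    using V_subspace unfolding V.subspace_def
    by (cases "word_odd w"; cases p) (auto simp: indF_par_def single_indF single_apply)
qed

lemma NF_par: "f \<in> indF_par V0 V1 p \<Longrightarrow> NF f \<in> indF_par V0 V1 p"
proof -
  assume f: "f \<in> indF_par V0 V1 p"
  then have fF: "f \<in> indF" by (simp add: indF_par_def)
  have "f w \<in> (if word_odd w = p then V0 else V1)" for w
    using f unfolding indF_par_def by blast
  then have "single w (f w) \<in> {f \<in> indF. NF f \<in> indF_par V0 V1 p}" for w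
    by (simp only: mem_Collect_eq NF_single single_indF nf_par simp_thms)
  then have "f \<in> {f \<in> indF. NF f \<in> indF_par V0 V1 p}"
    by (intro indF_mem_subspace[OF fF NF_preimage_subspace[OF indF_par_subspace]])
  then show ?thesis by simp
qed

end

subsection \<open>The weight filtration\<close>

fun dg :: "rgen \<Rightarrow> int" where
  "dg (RL m) = m"
| "dg (RG m) = m"
| "dg RC = 0"

lemma in_b_iff_dg: "in_b x \<longleftrightarrow> dg x \<ge> 0"
  by (cases x) auto

lemma rbr_dg: "(a, g) \<in> set (rbr x y) \<Longrightarrow> a \<noteq> 0 \<Longrightarrow> dg g = dg x + dg y"
  by (cases x; cases y; auto split: if_splits)

definition wt :: "rgen list \<Rightarrow> int" where
  "wt w = - sum_list (map dg w)"

lemma wt_simps [simp]: "wt [] = 0" "wt (x # w) = wt w - dg x" "wt (u @ w) = wt u + wt w"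
  by (simp_all add: wt_def)

definition neg :: "rgen list \<Rightarrow> bool" where
  "neg w \<longleftrightarrow> (\<forall>x\<in>set w. dg x < 0)"

lemma neg_simps [simp]: "neg []" "neg (x # w) \<longleftrightarrow> dg x < 0 \<and> neg w" "neg (u @ w) \<longleftrightarrow> neg u \<and> neg w"
  by (auto simp: neg_def)

lemma wt_nonneg: "neg w \<Longrightarrow> 0 \<le> wt w"
  by (induction w) auto

lemma wt_eq_0: "neg w \<Longrightarrow> wt w = 0 \<Longrightarrow> w = []"
  using wt_nonneg by (cases w) fastforce+

locale ind_rep = b_rep scale V0 V1 act
  for scale :: "complex \<Rightarrow> 'v::ab_group_add \<Rightarrow> 'v" and V0 V1 act +
  fixes t :: int
  assumes t_pos: "t > 0" and inj_t: "inj (act (RL t))"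
    and vanish_L: "i > t \<Longrightarrow> act (RL i) v = 0"
begin

text \<open>Use \<open>[L_i, G_0] = (i/2) G_i\<close>: both products on the left contain
  \<open>L_i\<close>, which kills V.\<close>

lemma vanish_G:
  assumes i: "i > t"
  shows "act (RG i) v = 0"
proof -
  have "act (RL i) (act (RG 0) v) = scale (sg (RL i) (RG 0)) (act (RG 0) (act (RL i) v))
     + lc scale (rbr (RL i) (RG 0)) (\<lambda>g. act g v)"
    using i t_pos by (intro act_rel) auto
  then have "scale (of_int i / 2) (act (RG i) v) = 0"
    by (simp add: vanish_L[OF i] act_zero)
  then show ?thesis using i t_pos by simp
qed

lemma vanish: "dg x > t \<Longrightarrow> act x v = 0"
  using t_pos vanish_L vanish_G by (cases x) auto

text \<open>The amount by which a generator of degree \<open>m\<close> raises weights at most: moved to the right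
  through a word, it hits \<open>V\<close> as a generator of degree at most \<open>t\<close>, the excess being
  taken out of the word.\<close>
definition om :: "int \<Rightarrow> int" where
  "om m = (if m < 0 then - m else if m \<le> t then 0 else t - m)"

lemma om_add: "m \<ge> 0 \<Longrightarrow> n < 0 \<Longrightarrow> om (m + n) \<le> om m - n"
  using t_pos by (auto simp: om_def)

definition Fil :: "int \<Rightarrow> (rgen list \<Rightarrow> 'v) set" where
  "Fil n = F.span (ind_rels scale act \<union> {single w v | w v. neg w \<and> wt w \<le> n})"

lemma Fil_subspace: "F.subspace (Fil n)"
  unfolding Fil_def by (rule F.subspace_span)

lemma K_Fil: "K \<subseteq> Fil n"
  unfolding Fil_def indK_def by (rule F.span_mono) auto

lemma Fil_mono: "m \<le> n \<Longrightarrow> Fil m \<subseteq> Fil n"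
  unfolding Fil_def by (rule F.span_mono) auto

lemma Fil_negative: "n < 0 \<Longrightarrow> Fil n = K"
proof -
  assume "n < 0"
  then have E: "{single w (v :: 'v) | w v. neg w \<and> wt w \<le> n} = {}"
    using wt_nonneg by fastforce
  show ?thesis unfolding Fil_def indK_def E Un_empty_right ..
qed

lemma single_Fil: "neg w \<Longrightarrow> wt w \<le> n \<Longrightarrow> single w v \<in> Fil n"
  unfolding Fil_def by (rule F.span_base) auto

lemma Fil_lactI:
  assumes gen: "\<And>w v. neg w \<Longrightarrow> wt w \<le> n \<Longrightarrow> lact x (single w v) \<in> Fil m"
    and f: "f \<in> Fil n"
  shows "lact x f \<in> Fil m"
proof -
  have "lact x f \<in> Fil m" if "f \<in> ind_rels scale act" for f
    using lact_K[of f x] K_Fil F.span_base[OF that] unfolding indK_def by blast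
  then have "ind_rels scale act \<union> {single w v | w v. neg w \<and> wt w \<le> n} \<subseteq> {f. lact x f \<in> Fil m}"
    using gen by auto
  from F.span_induct_subspace[OF f[unfolded Fil_def] lact_preimage_subspace[OF Fil_subspace] this]
  show ?thesis by simp
qed

lemma Fil_lact_neg: "dg x < 0 \<Longrightarrow> f \<in> Fil n \<Longrightarrow> lact x f \<in> Fil (n - dg x)"
  by (rule Fil_lactI) (auto simp: lact_single intro: single_Fil)

text \<open>Move \<open>x\<close> of degree at least 0 to the right. Passing \<open>y\<close> leaves
  a bracket of degree \<open>dg x + dg y\<close>, controlled by \<open>om_add\<close>; at the end
  \<open>x\<close> acts on V, and by 0 if its degree exceeds \<open>t\<close>, where
  \<open>om\<close> is negative.\<close>

lemma single_lact_Fil: "neg w \<Longrightarrow> single (x # w) v \<in> Fil (wt w + om (dg x))"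
proof (induction w arbitrary: x v)
  case Nil
  show ?case
  proof (cases "dg x < 0")
    case True
    then show ?thesis by (auto simp: om_def intro: single_Fil)
  next
    case False
    then have "single ([] @ [x]) v - single [] (act x v) \<in> K"
      by (intro K_absorb) (simp add: in_b_iff_dg)
    then have *: "single [x] v - single [] (act x v) \<in> Fil (om (dg x))"
      using K_Fil by auto
    have "single [] (act x v) \<in> Fil (om (dg x))"
    proof (cases "dg x \<le> t")
      case True
      then show ?thesis using False by (auto simp: om_def intro: single_Fil)
    next
      case False
      then have "single [] (act x v) = 0" by (simp add: vanish single_eq_0_iff)
      then show ?thesis using F.subspace_0[OF Fil_subspace] by (simp only:)
    qed
    from F.subspace_add[OF Fil_subspace * this] show ?thesis by simp
  qed
next
  case (Cons y w)
  show ?case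
  proof (cases "dg x < 0")
    case True
    then show ?thesis using Cons.prems by (auto simp: om_def intro: single_Fil)
  next
    case False
    let ?n = "wt (y # w) + om (dg x)"
    have y: "dg y < 0" and w: "neg w" using Cons.prems by auto
    have 1: "single ([] @ [x, y] @ w) v - (fscale scale (sg x y) (single ([] @ [y, x] @ w) v)
       + lc (fscale scale) (rbr x y) (\<lambda>g. single ([] @ [g] @ w) v)) \<in> Fil ?n"
      using K_rel K_Fil by blast
    have "lact y (single (x # w) v) \<in> Fil (wt w + om (dg x) - dg y)"
      by (intro Fil_lact_neg y Cons.IH w)
    then have 2: "fscale scale (sg x y) (single ([] @ [y, x] @ w) v) \<in> Fil ?n"
      by (intro F.subspace_scale[OF Fil_subspace]) (simp add: lact_single algebra_simps)
    have 3: "lc (fscale scale) (rbr x y) (\<lambda>g. single ([] @ [g] @ w) v) \<in> Fil ?n"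
    proof (rule F.lc_mem[OF Fil_subspace])
      fix a g assume "(a, g) \<in> set (rbr x y)" "a \<noteq> 0"
      then have "dg g = dg x + dg y" by (rule rbr_dg)
      then have "wt w + om (dg g) \<le> ?n" using om_add[of "dg x" "dg y"] False y by simp
      from Fil_mono[OF this] show "single ([] @ [g] @ w) v \<in> Fil ?n"
        using Cons.IH[OF w, of g v] by auto
    qed
    from F.subspace_add[OF Fil_subspace 1 F.subspace_add[OF Fil_subspace 2 3]]
    show ?thesis by simp
  qed
qed

lemma Fil_lact: "f \<in> Fil n \<Longrightarrow> lact x f \<in> Fil (n + om (dg x))"
proof (rule Fil_lactI)
  fix w v assume "neg w" "wt w \<le> n"
  then show "lact x (single w v) \<in> Fil (n + om (dg x))"
    using single_lact_Fil[of w x v] Fil_mono[of "wt w + om (dg x)" "n + om (dg x)"]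
    by (auto simp: lact_single)
qed

lemma single_word_Fil: "\<exists>n\<ge>0. \<forall>v. single w v \<in> Fil n"
proof (induction w)
  case Nil
  show ?case by (intro exI[of _ 0]) (auto intro: single_Fil)
next
  case (Cons x w)
  then obtain n where n: "n \<ge> 0" "\<And>v. single w v \<in> Fil n" by blast
  have "single (x # w) v \<in> Fil (n + max 0 (om (dg x)))" for v
    using Fil_lact[OF n(2)[of v], of x] Fil_mono[of "n + om (dg x)" "n + max 0 (om (dg x))"]
    by (auto simp: lact_single)
  then show ?case using n(1) by (intro exI[of _ "n + max 0 (om (dg x))"]) auto
qed

lemma indF_Fil:
  assumes "f \<in> indF"
  shows "\<exists>n\<ge>0. f \<in> Fil n"
proof -
  obtain b where b: "\<And>w. b w \<ge> 0" "\<And>w v. single w v \<in> Fil (b w)"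
    using single_word_Fil by metis
  let ?S = "{w. f w \<noteq> 0}"
  have fin: "finite ?S" using assms by (simp add: indF_def)
  \<comment> \<open>The bounds \<open>b w\<close> are nonnegative, so their sum dominates each of
    them and is 0 for empty support.\<close>
  have "f \<in> Fil (sum b ?S)"
  proof (rule indF_mem_subspace[OF assms Fil_subspace])
    fix w assume "f w \<noteq> 0"
    then have "b w \<le> sum b ?S" using b(1) fin by (intro member_le_sum) auto
    then show "single w (f w) \<in> Fil (sum b ?S)" using b(2) Fil_mono by blast
  qed
  moreover have "0 \<le> sum b ?S" using b(1) by (simp add: sum_nonneg)
  ultimately show ?thesis by blast
qed

text \<open>A generator of degree \<open>m > n + t\<close> sends \<open>Fil n\<close> to level
  \<open>n + t - m < 0\<close>, where the filtration is only \<open>K\<close>.\<close>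

lemma smooth: "ind_smooth scale act"
  unfolding ind_smooth_def
proof
  fix f :: "rgen list \<Rightarrow> 'v" assume "f \<in> indF"
  then obtain n where n: "n \<ge> 0" "f \<in> Fil n" using indF_Fil by blast
  have "lact x f \<in> K" if m: "m > n + t" and x: "in_Rm m x" for m x
  proof -
    have "dg x = m" using x m n t_pos by (auto simp: in_Rm_def)
    then have "n + om (dg x) < 0" using m n t_pos by (simp add: om_def)
    then show ?thesis using Fil_lact[OF n(2), of x] Fil_negative by simp
  qed
  then show "\<exists>n::nat. \<forall>m::int. m > int n \<longrightarrow> (\<forall>x. in_Rm m x \<longrightarrow> lact x f \<in> K)"
    using n t_pos by (intro exI[of _ "nat (n + t)"]) auto
qed

end

subsection \<open>Leading terms\<close>

text \<open>Not being bad is a transitive relation, so testing neighbours is the same as testing all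
  pairs.\<close>

lemma normal_iff: "normal w \<longleftrightarrow> sorted_wrt (\<lambda>x y. \<not> bad x y) w \<and> neg w"
proof -
  have "redex w = None \<longleftrightarrow> sorted_wrt (\<lambda>x y. \<not> bad x y) w"
  proof (induction w rule: redex.induct)
    case (1 x y w)
    have "\<not> bad x z" if "\<not> bad x y" "\<not> bad y z" for z
      using that key_inject[of x y] key_inject[of y z] by (auto simp: bad_def)
    then show ?case using 1 by auto
  qed auto
  then show ?thesis by (auto simp: normal_def neg_def in_b_iff_dg not_le)
qed

text \<open>The sign that arises when \<open>x\<close> is moved past all of
  \<open>w\<close>.\<close>

definition sgw :: "rgen \<Rightarrow> rgen list \<Rightarrow> complex" where
  "sgw x w = (\<Prod>y\<leftarrow>w. sg x y)"

lemma sgw_simps [simp]: "sgw x [] = 1" "sgw x (y # w) = sg x y * sgw x w" "sgw x (u @ w) = sgw x u * sgw x w"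
  by (simp_all add: sgw_def)

lemma sg_RL [simp]: "sg x (RL m) = 1"
  by (simp add: sg_def)

lemma sgw_replicate_RL [simp]: "sgw x (replicate a (RL m)) = 1"
  by (induction a) auto

lemma sgw_nonzero: "sgw x w \<noteq> 0"
  by (induction w) (auto simp: sg_def)

lemma wt_replicate [simp]: "wt (replicate a (RL (- j))) = j * int a"
  by (induction a) (auto simp: algebra_simps)

lemma neg_replicate [simp]: "j > 0 \<Longrightarrow> neg (replicate a (RL (- j)))"
  by (auto simp: neg_def)

text \<open>The part \<open>u\<close> is recovered by filtering for degrees below \<open>-j\<close>,
  and \<open>a\<close> by counting the letters \<open>L_{-j}\<close>.\<close>

lemma split_unique:
  assumes "\<forall>x\<in>set u. dg x < - j" "\<forall>x\<in>set u'. dg x < - j"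
    and "e \<in> {[], [RG (- j)]}" "e' \<in> {[], [RG (- j)]}"
  shows "u @ replicate a (RL (- j)) @ e = u' @ replicate a' (RL (- j)) @ e' \<longleftrightarrow> u = u' \<and> a = a' \<and> e = e'"
proof
  assume eq: "u @ replicate a (RL (- j)) @ e = u' @ replicate a' (RL (- j)) @ e'"
  have "filter (\<lambda>x. dg x < - j) (w @ replicate b (RL (- j)) @ d) = w"
    if "\<forall>x\<in>set w. dg x < - j" "d \<in> {[], [RG (- j)]}" for w b d
    using that by auto
  then have u: "u = u'" using assms eq by metis
  have "length (filter (\<lambda>x. x = RL (- j)) (replicate b (RL (- j)) @ d)) = b"
    if "d \<in> {[], [RG (- j)]}" for b d
    using that by auto
  then have "a = a'" using assms eq u by (metis same_append_eq)
  then show "u = u' \<and> a = a' \<and> e = e'" using u eq by simp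
qed simp

text \<open>Letters of the maximal degree \<open>-j\<close> come last in a sorted word, the even
  ones first, and the odd one occurs at most once.\<close>

lemma split_exists:
  assumes "normal w" "\<forall>x\<in>set w. dg x \<le> - j" "j > 0"
  obtains u a e where "w = u @ replicate a (RL (- j)) @ e" "\<forall>x\<in>set u. dg x < - j" "e \<in> {[], [RG (- j)]}"
  using assms
proof (induction w arbitrary: thesis)
  case Nil
  show ?case using Nil(1)[of "[]" 0 "[]"] by simp
next
  case (Cons x w)
  have w: "normal w" "\<forall>x\<in>set w. dg x \<le> - j" and sorted: "\<forall>y\<in>set w. \<not> bad x y"
    using Cons.prems by (auto simp: normal_iff)
  obtain u a e where IH: "w = u @ replicate a (RL (- j)) @ e" "\<forall>x\<in>set u. dg x < - j" "e \<in> {[], [RG (- j)]}"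
    using Cons.IH[OF _ w Cons.prems(4)] by metis
  have x: "dg x \<le> - j" using Cons.prems by simp
  then have RC: "x \<noteq> RC" using Cons.prems(4) by auto
  show ?case
  proof (cases "dg x < - j")
    case True
    then show ?thesis using IH Cons.prems(1)[of "x # u" a e] by simp
  next
    case False
    then have dx: "dg x = - j" using x by simp
    \<comment> \<open>A letter of degree \<open>-j\<close> in front of one of smaller degree would
      be a bad pair.\<close>
    have "False" if "y \<in> set u" for y
    proof -
      have "dg y < - j" "\<not> bad x y" using that IH sorted by auto
      then show False using dx RC by (cases x; cases y) (auto simp: bad_def)
    qed
    then have u: "u = []" by (cases u) auto
    show ?thesis
    proof (cases x)
      case (RL m)
      then show ?thesis using IH u dx Cons.prems(1)[of "[]" "Suc a" e] by simp
    next
      case (RG m)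
      then have "\<forall>y\<in>set w. y \<noteq> RL (- j) \<and> y \<noteq> RG (- j)" using sorted dx by (auto simp: bad_def)
      then have "w = []" using IH u by (cases a) auto
      then show ?thesis using RG dx Cons.prems(1)[of "[]" 0 "[RG (- j)]"] by simp
    qed (use RC in simp)
  qed
qed

section \<open>Operators of degree \<open>j + t\<close> modulo lower weights\<close>

context ind_rep
begin

definition eqv :: "int \<Rightarrow> (rgen list \<Rightarrow> 'v) \<Rightarrow> (rgen list \<Rightarrow> 'v) \<Rightarrow> bool" where
  "eqv n f g \<longleftrightarrow> f - g \<in> Fil n"

lemma eqv_refl: "eqv n f f"
  unfolding eqv_def by (simp only: diff_self F.subspace_0[OF Fil_subspace])

lemma eqv_trans [trans]: "eqv n f g \<Longrightarrow> eqv n g h \<Longrightarrow> eqv n f h"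
  unfolding eqv_def using F.subspace_add[OF Fil_subspace, of "f - g" n "g - h"] by (simp only: diff_add_diff)

lemma eqv_add: "eqv n f g \<Longrightarrow> eqv n f' g' \<Longrightarrow> eqv n (f + f') (g + g')"
  unfolding eqv_def using F.subspace_add[OF Fil_subspace, of "f - g" n "f' - g'"] by (simp only: add_diff_add)

lemma eqv_scale: "eqv n f g \<Longrightarrow> eqv n (fscale scale c f) (fscale scale c g)"
  unfolding eqv_def using F.subspace_scale[OF Fil_subspace, of "f - g" n c]
  by (simp only: F.scale_right_diff_distrib)

lemma eqv_lact: "dg x < 0 \<Longrightarrow> eqv n f g \<Longrightarrow> eqv (n - dg x) (lact x f) (lact x g)"
  unfolding eqv_def lact_diff[symmetric] by (rule Fil_lact_neg)

lemma eqv_K: "f - g \<in> K \<Longrightarrow> eqv n f g"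
  unfolding eqv_def using K_Fil by blast

lemma eqv_lacts: "neg u \<Longrightarrow> eqv n f g \<Longrightarrow> eqv (n + wt u) (foldr lact u f) (foldr lact u g)"
proof (induction u)
  case (Cons x u)
  then have "eqv (n + wt u - dg x) (lact x (foldr lact u f)) (lact x (foldr lact u g))"
    by (intro eqv_lact) auto
  then show ?case by (simp add: algebra_simps)
qed simp

lemma lacts_single: "foldr lact u (single w v) = single (u @ w) v"
  by (induction u) (simp_all add: lact_single)

lemma lacts_add: "foldr lact u (f + g) = foldr lact u f + foldr lact u (g :: _ \<Rightarrow> 'v)"
  by (induction u) (simp_all only: foldr.simps comp_apply lact_add id_apply)

lemma lacts_scale: "foldr lact u (fscale scale c f) = fscale scale c (foldr lact u f)"
  by (induction u) (simp_all only: foldr.simps comp_apply lact_scale id_apply)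

text \<open>The bracket of \<open>x\<close> with \<open>y\<close> has degree below \<open>t\<close>,
  so replacing the pair by it loses more than \<open>j\<close> in weight and lands strictly below
  the leading term.\<close>

lemma om_pass: "j \<ge> 0 \<Longrightarrow> dg x = j + t \<Longrightarrow> dg y < - j \<Longrightarrow> om (dg x + dg y) \<le> - j - 1 - dg y"
  using t_pos by (auto simp: om_def)

text \<open>By \<open>om_pass\<close> the brackets with letters of degree below \<open>-j\<close>
  are negligible, so \<open>x\<close> moves through \<open>u\<close> at the cost of a sign.\<close>

lemma eqv_pass:
  assumes "j \<ge> 0" "dg x = j + t" "\<forall>y\<in>set u. dg y < - j" "neg w"
  shows "eqv (wt u + wt w - j - 1) (single (x # u @ w) v) (fscale scale (sgw x u) (single (u @ x # w) v))"
  using assms(3)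
proof (induction u)
  case Nil
  show ?case by (simp add: eqv_refl)
next
  case (Cons y u)
  let ?n = "wt (y # u) + wt w - j - 1"
  have u: "neg u" using Cons.prems assms(1) by (auto simp: neg_def)
  have y: "dg y < 0" "dg y < - j" using Cons.prems assms(1) by auto
  have "lc (fscale scale) (rbr x y) (\<lambda>g. single ([] @ [g] @ u @ w) v) \<in> Fil ?n"
  proof (rule F.lc_mem[OF Fil_subspace])
    fix a g assume "(a, g) \<in> set (rbr x y)" "a \<noteq> 0"
    then have "om (dg g) \<le> - j - 1 - dg y" using om_pass[OF assms(1,2) y(2)] rbr_dg by simp
    then have "wt (u @ w) + om (dg g) \<le> ?n" by simp
    from Fil_mono[OF this] show "single ([] @ [g] @ u @ w) v \<in> Fil ?n"
      using single_lact_Fil[of "u @ w" g v] u assms(4) by auto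
  qed
  moreover have "single ([] @ [x, y] @ u @ w) v - (fscale scale (sg x y) (single ([] @ [y, x] @ u @ w) v)
       + lc (fscale scale) (rbr x y) (\<lambda>g. single ([] @ [g] @ u @ w) v)) \<in> Fil ?n"
    using K_rel K_Fil by blast
  ultimately have "single ([] @ [x, y] @ u @ w) v - (fscale scale (sg x y) (single ([] @ [y, x] @ u @ w) v)
       + lc (fscale scale) (rbr x y) (\<lambda>g. single ([] @ [g] @ u @ w) v))
       + lc (fscale scale) (rbr x y) (\<lambda>g. single ([] @ [g] @ u @ w) v) \<in> Fil ?n"
    by (intro F.subspace_add[OF Fil_subspace])
  then have "eqv ?n (single (x # y # u @ w) v) (fscale scale (sg x y) (lact y (single (x # u @ w) v)))"
    by (simp add: eqv_def lact_single diff_diff_eq[symmetric])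
  also have "eqv (wt u + wt w - j - 1 - dg y) (lact y (single (x # u @ w) v))
      (lact y (fscale scale (sgw x u) (single (u @ x # w) v)))"
    using Cons y by (intro eqv_lact) auto
  then have "eqv ?n (fscale scale (sg x y) (lact y (single (x # u @ w) v)))
      (fscale scale (sg x y) (lact y (fscale scale (sgw x u) (single (u @ x # w) v))))"
    by (intro eqv_scale) (simp add: algebra_simps)
  finally show ?case by (simp add: lact_scale lact_single)
qed

text \<open>For \<open>j = 0\<close> every negative letter can be passed, and \<open>x\<close>
  arrives at V.\<close>

lemma eqv_pass_t:
  assumes "dg x = t" "neg u"
  shows "eqv (wt u - 1) (single (x # u) v) (fscale scale (sgw x u) (single u (act x v)))"
proof -
  have "eqv (wt u - 1) (single (x # u) v) (fscale scale (sgw x u) (single (u @ [x]) v))"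
    using eqv_pass[of 0 x u "[]" v] assms by (auto simp: neg_def)
  also have "eqv (wt u - 1) (fscale scale (sgw x u) (single (u @ [x]) v)) (fscale scale (sgw x u) (single u (act x v)))"
    using assms t_pos by (intro eqv_scale eqv_K K_absorb) (simp add: in_b_iff_dg)
  finally show ?thesis .
qed

text \<open>\<open>[D b j, L\<^bsub>-j\<^esub>] = cL b j X b\<close> and \<open>[D b j, G\<^bsub>-j\<^esub>] = cG b j X (\<not> b)\<close>.\<close>
definition D :: "bool \<Rightarrow> int \<Rightarrow> rgen" where
  "D b j = (if b then RG (j + t) else RL (j + t))"

definition X :: "bool \<Rightarrow> rgen" where
  "X b = (if b then RG t else RL t)"

definition cL :: "bool \<Rightarrow> int \<Rightarrow> complex" where
  "cL b j = (if b then 3 * of_int j / 2 + of_int t else 2 * of_int j + of_int t)"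

definition cG :: "bool \<Rightarrow> int \<Rightarrow> complex" where
  "cG b j = (if b then 2 else (of_int j + of_int t) / 2 + of_int j)"

lemma dg_D [simp]: "dg (D b j) = j + t" and dg_X [simp]: "dg (X b) = t"
  by (auto simp: D_def X_def)

lemma in_b_X: "in_b (X b)"
  using t_pos by (simp add: in_b_iff_dg)

lemma rbr_D_RL: "lc (fscale scale) (rbr (D b j) (RL (- j))) f = fscale scale (cL b j) (f (X b))"
  using t_pos by (simp add: D_def X_def cL_def)

lemma rbr_D_RG: "lc (fscale scale) (rbr (D b j) (RG (- j))) f = fscale scale (cG b j) (f (X (\<not> b)))"
  using t_pos by (simp add: D_def X_def cG_def)

text \<open>The Leibniz rule on a power of \<open>L_{-j}\<close>: each factor contributes
  \<open>cL b j\<close> times \<open>X b\<close>, which by \<open>eqv_pass_t\<close> travels on to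
  V.\<close>

lemma eqv_power:
  assumes j: "j > 0" and w: "neg w"
  shows "eqv (wt w + j * int a - j - 1) (single (D b j # replicate a (RL (- j)) @ w) v)
    (single (replicate a (RL (- j)) @ D b j # w) v
      + fscale scale (of_nat a * cL b j * sgw (X b) w) (single (replicate (a - 1) (RL (- j)) @ w) (act (X b) v)))"
proof (induction a)
  case 0
  show ?case by (simp add: eqv_refl)
next
  case (Suc a)
  let ?n = "wt w + j * int (Suc a) - j - 1"
  let ?y = "RL (- j)"
  let ?R = "\<lambda>a. single (replicate a ?y @ w) (act (X b) v)"
  have y: "dg ?y < 0" and lev: "wt w + j * int a - j - 1 - dg ?y = ?n"
    using j by (simp_all add: algebra_simps)
  have "eqv ?n (single ([] @ [D b j, ?y] @ replicate a ?y @ w) v)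
      (fscale scale (sg (D b j) ?y) (single ([] @ [?y, D b j] @ replicate a ?y @ w) v)
       + lc (fscale scale) (rbr (D b j) ?y) (\<lambda>g. single ([] @ [g] @ replicate a ?y @ w) v))"
    by (intro eqv_K K_rel)
  then have "eqv ?n (single (D b j # replicate (Suc a) ?y @ w) v)
      (lact ?y (single (D b j # replicate a ?y @ w) v)
       + fscale scale (cL b j) (single (X b # replicate a ?y @ w) v))"
    by (simp add: rbr_D_RL lact_single)
  also have "eqv ?n \<dots> (lact ?y (single (replicate a ?y @ D b j # w) v
      + fscale scale (of_nat a * cL b j * sgw (X b) w) (?R (a - 1)))
      + fscale scale (cL b j) (fscale scale (sgw (X b) w) (?R a)))"
  proof (intro eqv_add eqv_scale)
    show "eqv ?n (lact ?y (single (D b j # replicate a ?y @ w) v))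
      (lact ?y (single (replicate a ?y @ D b j # w) v + fscale scale (of_nat a * cL b j * sgw (X b) w) (?R (a - 1))))"
      using eqv_lact[OF y Suc.IH] unfolding lev .
    show "eqv ?n (single (X b # replicate a ?y @ w) v) (fscale scale (sgw (X b) w) (?R a))"
      using eqv_pass_t[of "X b" "replicate a ?y @ w" v] j w by (simp add: algebra_simps)
  qed
  also have "lact ?y (single (replicate a ?y @ D b j # w) v
      + fscale scale (of_nat a * cL b j * sgw (X b) w) (?R (a - 1)))
      + fscale scale (cL b j) (fscale scale (sgw (X b) w) (?R a))
    = single (replicate (Suc a) ?y @ D b j # w) v
      + fscale scale (of_nat (Suc a) * cL b j * sgw (X b) w) (?R (Suc a - 1))"
  \<comment> \<open>For \<open>a = 0\<close> the truncated exponent \<open>a - 1\<close> is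
    harmless, as its term has coefficient 0.\<close>
  proof (cases a)
    case 0
    then show ?thesis by (simp add: lact_add lact_scale lact_single)
  next
    case (Suc a')
    have "of_nat (Suc a) * cL b j * sgw (X b) w = of_nat a * cL b j * sgw (X b) w + cL b j * sgw (X b) w"
      by (simp add: algebra_simps)
    then show ?thesis
      unfolding lact_add lact_scale lact_single by (simp add: F.scale_left_distrib Suc add.assoc)
  qed
  finally show ?case .
qed

text \<open>The degree \<open>j + t\<close> exceeds \<open>t\<close>, so the operator kills V; the
  congruence holds modulo \<open>K\<close>, hence at every level.\<close>

lemma eqv_end_Nil:
  assumes j: "j > 0"
  shows "eqv n (single [D b j] v) 0"
proof -
  have "eqv n (single ([] @ [D b j]) v) (single [] (act (D b j) v))"
    using j t_pos by (intro eqv_K K_absorb) (simp add: in_b_iff_dg)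
  moreover have "single [] (act (D b j) v) = 0"
    using j by (simp only: single_eq_0_iff vanish dg_D)
  ultimately show ?thesis by (simp only: append_Nil)
qed

lemma eqv_end_RG:
  assumes j: "j > 0"
  shows "eqv n (single [D b j, RG (- j)] v) (fscale scale (cG b j) (single [] (act (X (\<not> b)) v)))"
proof -
  have "eqv n (single ([] @ [D b j, RG (- j)] @ []) v)
      (fscale scale (sg (D b j) (RG (- j))) (single ([] @ [RG (- j), D b j] @ []) v)
       + lc (fscale scale) (rbr (D b j) (RG (- j))) (\<lambda>g. single ([] @ [g] @ []) v))"
    by (intro eqv_K K_rel)
  also have "\<dots> = fscale scale (sg (D b j) (RG (- j))) (lact (RG (- j)) (single [D b j] v))
       + fscale scale (cG b j) (single ([] @ [X (\<not> b)]) v)"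
    by (simp only: rbr_D_RG lact_single append_Nil append_Nil2 append_Cons)
  also have "eqv n \<dots> (fscale scale (sg (D b j) (RG (- j))) (lact (RG (- j)) 0)
       + fscale scale (cG b j) (single [] (act (X (\<not> b)) v)))"
    using eqv_lact[of "RG (- j)" "n - j", OF _ eqv_end_Nil[OF j]] j
    by (intro eqv_add eqv_scale eqv_K[OF K_absorb] in_b_X) auto
  finally show ?thesis by (simp only: lact_zero F.scale_zero_right add_0 append_Nil append_Nil2 append_Cons)
qed

end

section \<open>Leading components and the descent in weight\<close>

context ind_rep
begin

definition homog :: "int \<Rightarrow> (rgen list \<Rightarrow> 'v) set" where
  "homog n = {f \<in> indF. \<forall>w. f w \<noteq> 0 \<longrightarrow> normal w \<and> wt w = n}"

lemma homog_subspace: "F.subspace (homog n)"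
  unfolding homog_def by (rule subspace_support)

lemma single_homog: "normal w \<Longrightarrow> wt w = n \<Longrightarrow> single w v \<in> homog n"
  by (auto simp: homog_def single_indF) (simp_all add: single_apply split: if_splits)

text \<open>The coefficient at the word \<open>u L\<^bsub>-j\<^esub>\<^sup>a\<close> of the leading component of \<open>D b j \<sigma>\<close>; the words containing
  \<open>G\<^bsub>-j\<^esub>\<close> are not needed to detect that \<open>\<sigma>\<close> has a letter of degree \<open>-j\<close>.\<close>
definition sym_at :: "bool \<Rightarrow> int \<Rightarrow> (rgen list \<Rightarrow> 'v) \<Rightarrow> rgen list \<Rightarrow> nat \<Rightarrow> 'v" where
  "sym_at b j \<sigma> u a = scale (sgw (D b j) u)
     (scale (of_nat (Suc a) * cL b j) (act (X b) (\<sigma> (u @ replicate (Suc a) (RL (- j)))))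
      + scale (cG b j) (act (X (\<not> b)) (\<sigma> (u @ replicate a (RL (- j)) @ [RG (- j)]))))"

text \<open>Stated as a relation so that a leading component \<open>\<tau>\<close> can be written
  down for single words and then carried to sums by \<open>sym_subspace\<close>.\<close>

definition is_sym :: "bool \<Rightarrow> int \<Rightarrow> int \<Rightarrow> (rgen list \<Rightarrow> 'v) \<Rightarrow> (rgen list \<Rightarrow> 'v) \<Rightarrow> bool" where
  "is_sym b j n \<sigma> \<tau> \<longleftrightarrow> \<tau> \<in> homog (n - j) \<and> eqv (n - j - 1) (lact (D b j) \<sigma>) \<tau> \<and>
     (\<forall>u a. (\<forall>x\<in>set u. dg x < - j) \<longrightarrow> \<tau> (u @ replicate a (RL (- j))) = sym_at b j \<sigma> u a)"

lemma sym_subspace: "F.subspace {\<sigma> \<in> indF. \<exists>\<tau>. is_sym b j n \<sigma> \<tau>}" (is "F.subspace ?S")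
proof (rule F.subspaceI)
  have "is_sym b j n 0 0"
    using F.subspace_0[OF homog_subspace]
    by (simp add: is_sym_def sym_at_def act_zero in_b_X lact_zero eqv_refl)
  then show "0 \<in> ?S" using F.subspace_0[OF subspace_indF] by blast
next
  fix f g assume f: "f \<in> ?S" and g: "g \<in> ?S"
  from f obtain \<tau> where \<tau>: "is_sym b j n f \<tau>" by auto
  from g obtain \<rho> where \<rho>: "is_sym b j n g \<rho>" by auto
  have "sym_at b j (f + g) u a = sym_at b j f u a + sym_at b j g u a" for u a
    by (simp add: sym_at_def act_add in_b_X V.scale_right_distrib)
  then have "is_sym b j n (f + g) (\<tau> + \<rho>)"
    using \<tau> \<rho> unfolding is_sym_def lact_add
    by (auto intro: F.subspace_add[OF homog_subspace] eqv_add)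
  then show "f + g \<in> ?S" using f g F.subspace_add[OF subspace_indF] by blast
next
  fix c f assume f: "f \<in> ?S"
  then obtain \<tau> where \<tau>: "is_sym b j n f \<tau>" by auto
  have "sym_at b j (fscale scale c f) u a = scale c (sym_at b j f u a)" for u a
    by (simp add: sym_at_def fscale_def act_scale in_b_X V.scale_right_distrib mult.commute mult.left_commute)
  moreover have "fscale scale c \<tau> w = scale c (\<tau> w)" for w by (simp add: fscale_def)
  ultimately have "is_sym b j n (fscale scale c f) (fscale scale c \<tau>)"
    using \<tau> unfolding is_sym_def lact_scale
    by (auto intro: F.subspace_scale[OF homog_subspace] eqv_scale)
  then show "fscale scale c f \<in> ?S" using f F.subspace_scale[OF subspace_indF] by blast
qed

text \<open>Split the word as \<open>u L_{-j}^a e\<close>. The operator passes \<open>u\<close> by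
  \<open>eqv_pass\<close>, expands on the power by \<open>eqv_power\<close>, and is evaluated on
  \<open>e\<close> by \<open>eqv_end_Nil\<close> or \<open>eqv_end_RG\<close>.\<close>

lemma sym_single:
  assumes w: "normal w" "wt w = n" "\<forall>x\<in>set w. dg x \<le> - j" and j: "j > 0"
  shows "\<exists>\<tau>. is_sym b j n (single w v) \<tau>"
proof -
  let ?y = "RL (- j)"
  obtain u a e where e: "w = u @ replicate a ?y @ e" "\<forall>x\<in>set u. dg x < - j" "e \<in> {[], [RG (- j)]}"
    using split_exists[OF w(1,3) j] .
  have neg: "neg u" "neg e" using e(2,3) j by (auto simp: neg_def)
  have n: "n = wt u + j * int a + wt e" using w(2) e(1) by simp
  define c where "c = (if e = [] then 0 else cG b j)"
  \<comment> \<open>The first term comes from the bracket with a final \<open>G_{-j}\<close>, absent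
    for empty \<open>e\<close>; the second comes from the brackets with the letters
    \<open>L_{-j}\<close>.\<close>
  define \<tau> where "\<tau> = fscale scale (sgw (D b j) u)
      (fscale scale c (single (u @ replicate a ?y) (act (X (\<not> b)) v))
       + fscale scale (of_nat a * cL b j * sgw (X b) e) (single (u @ replicate (a - 1) ?y @ e) (act (X b) v)))"
  have "eqv (wt u + wt (replicate a ?y @ e) - j - 1) (single (D b j # u @ replicate a ?y @ e) v)
      (fscale scale (sgw (D b j) u) (single (u @ D b j # replicate a ?y @ e) v))"
    using neg e(2) j by (intro eqv_pass) auto
  then have 1: "eqv (n - j - 1) (lact (D b j) (single w v))
      (fscale scale (sgw (D b j) u) (single (u @ D b j # replicate a ?y @ e) v))"
    by (simp add: lact_single e(1) n algebra_simps)
  have "eqv (wt e + j * int a - j - 1 + wt u) (foldr lact u (single (D b j # replicate a ?y @ e) v))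
     (foldr lact u (single (replicate a ?y @ D b j # e) v
      + fscale scale (of_nat a * cL b j * sgw (X b) e) (single (replicate (a - 1) ?y @ e) (act (X b) v))))"
    by (intro eqv_lacts eqv_power neg j)
  moreover have "wt e + j * int a - j - 1 + wt u = n - j - 1" by (simp add: n)
  ultimately have 2: "eqv (n - j - 1) (single (u @ D b j # replicate a ?y @ e) v)
     (foldr lact (u @ replicate a ?y) (single (D b j # e) v)
      + fscale scale (of_nat a * cL b j * sgw (X b) e) (single (u @ replicate (a - 1) ?y @ e) (act (X b) v)))"
    by (simp only: lacts_single lacts_add lacts_scale append_assoc)
  \<comment> \<open>The end terms agree at every level; this one becomes \<open>n - j - 1\<close>
    after multiplication by \<open>u L_{-j}^a\<close>.\<close>
  have "eqv (n - j - 1 - wt (u @ replicate a ?y)) (single (D b j # e) v) (fscale scale c (single [] (act (X (\<not> b)) v)))"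
    using e(3) eqv_end_Nil[OF j] eqv_end_RG[OF j] by (auto simp: c_def)
  then have "eqv (n - j - 1 - wt (u @ replicate a ?y) + wt (u @ replicate a ?y))
      (foldr lact (u @ replicate a ?y) (single (D b j # e) v))
      (foldr lact (u @ replicate a ?y) (fscale scale c (single [] (act (X (\<not> b)) v))))"
    using neg j by (intro eqv_lacts) auto
  then have 3: "eqv (n - j - 1) (foldr lact (u @ replicate a ?y) (single (D b j # e) v))
      (fscale scale c (single (u @ replicate a ?y) (act (X (\<not> b)) v)))"
    by (simp only: lacts_scale lacts_single append_Nil2 diff_add_cancel)
  have "eqv (n - j - 1) (lact (D b j) (single w v)) \<tau>"
    unfolding \<tau>_def
    by (rule eqv_trans[OF 1]) (intro eqv_scale eqv_trans[OF 2] eqv_add 3 eqv_refl)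
  \<comment> \<open>Each nonzero term arises by deleting one letter of degree \<open>-j\<close>: the
    word stays normal and its weight drops by \<open>j\<close>.\<close>
  moreover have "\<tau> \<in> homog (n - j)"
  proof -
    have "fscale scale c (single (u @ replicate a ?y) (act (X (\<not> b)) v)) \<in> homog (n - j)"
    proof (cases "e = []")
      case True
      then show ?thesis using F.subspace_0[OF homog_subspace] by (simp add: c_def)
    next
      case False
      then have "e = [RG (- j)]" using e(3) by simp
      then show ?thesis
        using w(1) e(1) n
        by (intro F.subspace_scale[OF homog_subspace] single_homog) (auto simp: normal_iff sorted_wrt_append)
    qed
    moreover have "fscale scale (of_nat a * cL b j * sgw (X b) e) (single (u @ replicate (a - 1) ?y @ e) (act (X b) v)) \<in> homog (n - j)"
    proof (cases a)
      case 0
      then show ?thesis using F.subspace_0[OF homog_subspace] by simp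
    next
      case (Suc a')
      then show ?thesis
        using w(1) e(1) n
        by (intro F.subspace_scale[OF homog_subspace] single_homog) (auto simp: normal_iff sorted_wrt_append algebra_simps)
    qed
    ultimately show ?thesis
      unfolding \<tau>_def by (rule F.subspace_scale[OF homog_subspace F.subspace_add[OF homog_subspace]])
  qed
  moreover have "\<tau> (u' @ replicate a' ?y) = sym_at b j (single w v) u' a'" if u': "\<forall>x\<in>set u'. dg x < - j" for u' a'
  proof -
    note eq = split_unique[OF u' e(2) _ e(3), of "[]" a' a] split_unique[OF u' e(2) _ _, of "[]" "[]" a' a]
      split_unique[OF u' e(2) _ e(3), of "[]" a' "a - 1"]
      split_unique[OF u' e(2) _ e(3), of "[]" "Suc a'" a]
      split_unique[OF u' e(2) _ e(3), of "[RG (- j)]" a' a]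
    show ?thesis
      using e(3) eq
      by (cases a) (auto simp: \<tau>_def sym_at_def c_def e(1) fscale_def single_apply act_zero in_b_X)
  qed
  ultimately show ?thesis unfolding is_sym_def by blast
qed

lemma act_t_inj: "act (RL t) v = 0 \<Longrightarrow> v = 0"
  using injD[OF inj_t, of v 0] act_zero[of "RL t"] t_pos by simp

text \<open>On V, \<open>G_t\<close> squares to \<open>L_{2t} = 0\<close> and commutes with
  \<open>L_t\<close>, since \<open>G_{2t}\<close> vanishes. Applying \<open>G_t\<close> to the first
  equation leaves \<open>L_t G_t p = 0\<close>, so \<open>G_t p = 0\<close>; then the second gives
  \<open>q = 0\<close> and the first \<open>p = 0\<close>.\<close>

lemma kernel_zero:
  assumes pq: "scale \<alpha> (act (RL t) p) + scale \<beta> (act (RG t) q) = 0"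
    "scale \<gamma> (act (RG t) p) + scale \<delta> (act (RL t) q) = 0"
    and "\<alpha> \<noteq> 0" "\<delta> \<noteq> 0"
  shows "p = 0 \<and> q = 0"
proof -
  have L: "in_b (RL t)" and G: "in_b (RG t)" using t_pos by auto
  have "act (RG t) (act (RG t) q) = - act (RG t) (act (RG t) q)"
    using act_rel[OF G G, of q] t_pos by (simp add: sg_def vanish)
  then have GG: "act (RG t) (act (RG t) q) = 0"
    using V.half_of_double[of "act (RG t) (act (RG t) q)"] by (metis add.left_inverse V.scale_zero_right)
  have GL: "act (RG t) (act (RL t) p) = act (RL t) (act (RG t) p)"
    using act_rel[OF L G, of p] t_pos by (simp add: sg_def vanish)
  have "act (RG t) (scale \<alpha> (act (RL t) p) + scale \<beta> (act (RG t) q)) = 0"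
    unfolding pq(1) by (rule act_zero[OF G])
  then have "act (RL t) (act (RG t) p) = 0"
    using assms(3) t_pos by (simp add: act_add act_scale GG GL)
  then have "act (RG t) p = 0" by (rule act_t_inj)
  then have "q = 0" using pq(2) assms(4) act_t_inj by simp
  then have "p = 0" using pq(1) assms(3) act_t_inj t_pos by (simp add: act_zero)
  then show ?thesis using \<open>q = 0\<close> by simp
qed

text \<open>The even and the odd operator give a system for the two coefficients as in
  \<open>kernel_zero\<close>; the factors of \<open>L_t\<close> are \<open>(a + 1) (2 j + t)\<close>
  and \<open>cG True j = 2\<close>, both nonzero.\<close>

lemma sym_at_zero:
  assumes "sym_at False j \<sigma> u a = 0" "sym_at True j \<sigma> u a = 0" and j: "j > 0"
  shows "\<sigma> (u @ replicate (Suc a) (RL (- j))) = 0 \<and> \<sigma> (u @ replicate a (RL (- j)) @ [RG (- j)]) = 0"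
proof (rule kernel_zero[where \<delta> = 2])
  have "(of_int (2 * j + t) :: complex) \<noteq> 0"
    using j t_pos by (simp only: of_int_eq_0_iff)
  then show "of_nat (Suc a) * cL False j \<noteq> 0"
    by (simp add: cL_def del: of_nat_Suc)
qed (use assms in \<open>simp_all add: sym_at_def sgw_nonzero X_def cG_def del: of_nat_Suc\<close>)

lemma lowest_component:
  assumes W: "F.subspace W" "K \<subseteq> W" "\<And>x f. f \<in> W \<Longrightarrow> lact x f \<in> W"
  shows "f \<in> W \<Longrightarrow> \<sigma> \<in> homog n \<Longrightarrow> \<sigma> \<noteq> 0 \<Longrightarrow> eqv (n - 1) f \<sigma> \<Longrightarrow> \<exists>v. v \<noteq> 0 \<and> single [] v \<in> W"
proof (induction "nat n" arbitrary: n f \<sigma> rule: less_induct)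
  case less
  have supp: "normal w" "wt w = n" "neg w" if "\<sigma> w \<noteq> 0" for w
    using less.prems(2) that by (auto simp: homog_def normal_iff)
  obtain w0 where w0: "\<sigma> w0 \<noteq> 0" using less.prems(3) by (auto simp: fun_eq_iff)
  then have "n \<ge> 0" using supp wt_nonneg by blast
  then consider "n = 0" | "n > 0" by linarith
  then show ?case
  proof cases
    case 1
    \<comment> \<open>Only the empty word has weight 0, and \<open>Fil (- 1)\<close> is
      \<open>K\<close>, so \<open>f\<close> agrees modulo \<open>K\<close> with a vector of
      V.\<close>
    have "\<sigma> w = 0" if "w \<noteq> []" for w using supp wt_eq_0 1 that by blast
    then have \<sigma>: "\<sigma> = single [] (\<sigma> [])" by (auto simp: single_apply fun_eq_iff)
    have "f - \<sigma> \<in> W" using less.prems(4) 1 W(2) Fil_negative[of "- 1"] by (auto simp: eqv_def)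
    from F.subspace_diff[OF W(1) less.prems(1) this] have "single [] (\<sigma> []) \<in> W"
      using \<sigma> by (simp only: diff_diff_eq2 add_diff_cancel_left')
    moreover have "\<sigma> [] \<noteq> 0" using w0 \<open>\<And>w. w \<noteq> [] \<Longrightarrow> \<sigma> w = 0\<close> by metis
    ultimately show ?thesis by blast
  next
    case 2
    let ?A = "\<Union>w\<in>{w. \<sigma> w \<noteq> 0}. (\<lambda>x. - dg x) ` set w"
    define j where "j = Min ?A"
    have fin: "finite ?A" using less.prems(2) by (auto simp: homog_def indF_def)
    have "w0 \<noteq> []" using supp(2)[OF w0] 2 by auto
    then have ne: "?A \<noteq> {}" using w0 by auto
    from Min_in[OF fin ne] obtain w1 x1 where w1: "\<sigma> w1 \<noteq> 0" "x1 \<in> set w1" "dg x1 = - j"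
      unfolding j_def by auto
    have le: "dg x \<le> - j" if "\<sigma> w \<noteq> 0" "x \<in> set w" for w x
      using Min_le[OF fin, of "- dg x"] that unfolding j_def by force
    have j: "j > 0" using supp(3)[OF w1(1)] w1(2,3) by (auto simp: neg_def)
    have "\<sigma> \<in> {\<sigma> \<in> indF. \<exists>\<tau>. is_sym b j n \<sigma> \<tau>}" for b
    proof (rule indF_mem_subspace[OF _ sym_subspace])
      show "\<sigma> \<in> indF" using less.prems(2) by (simp add: homog_def)
      fix w assume w: "\<sigma> w \<noteq> 0"
      show "single w (\<sigma> w) \<in> {\<sigma> \<in> indF. \<exists>\<tau>. is_sym b j n \<sigma> \<tau>}"
        using sym_single[OF supp(1,2)[OF w] _ j] le[OF w] single_indF by blast
    qed
    then obtain \<tau> where \<tau>: "\<And>b. is_sym b j n \<sigma> (\<tau> b)" by (simp only: mem_Collect_eq) metis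
    show ?thesis
    proof (cases "\<exists>b. \<tau> b \<noteq> 0")
      case True
      then obtain b where b: "\<tau> b \<noteq> 0" by blast
      \<comment> \<open>Since \<open>om (j + t) = - j\<close>, the error \<open>f - \<sigma>\<close>
        falls by \<open>j\<close> together with the leading term.\<close>
      have "n - 1 + om (dg (D b j)) = n - j - 1" using j t_pos by (simp add: om_def)
      then have "eqv (n - j - 1) (lact (D b j) f) (lact (D b j) \<sigma>)"
        using Fil_lact[of "f - \<sigma>" "n - 1" "D b j"] less.prems(4) by (simp only: eqv_def lact_diff)
      then have "eqv (n - j - 1) (lact (D b j) f) (\<tau> b)"
        using \<tau>[of b] eqv_trans unfolding is_sym_def by blast
      then show ?thesis
        using less.hyps[of "n - j" "lact (D b j) f" "\<tau> b"] W(3)[OF less.prems(1)] \<tau>[of b] b 2 j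
        by (simp add: is_sym_def)
    next
      case False
      \<comment> \<open>If both leading components vanish, so do all coefficients of
        \<open>\<sigma>\<close> at words containing a letter of degree \<open>-j\<close>, against
        the choice of \<open>w1\<close>.\<close>
      have "sym_at b j \<sigma> u a = 0" if "\<forall>x\<in>set u. dg x < - j" for b u a
      proof -
        have "\<tau> b (u @ replicate a (RL (- j))) = sym_at b j \<sigma> u a"
          using \<tau>[of b] that unfolding is_sym_def by blast
        then show ?thesis using False by simp
      qed
      then have zero: "\<sigma> (u @ replicate (Suc a) (RL (- j))) = 0" "\<sigma> (u @ replicate a (RL (- j)) @ [RG (- j)]) = 0"
        if "\<forall>x\<in>set u. dg x < - j" for u a
        using sym_at_zero[OF _ _ j] that by blast+
      have "\<forall>x\<in>set w1. dg x \<le> - j" using le[OF w1(1)] by blast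
      then obtain u a e where e: "w1 = u @ replicate a (RL (- j)) @ e" "\<forall>x\<in>set u. dg x < - j" "e \<in> {[], [RG (- j)]}"
        using split_exists[OF supp(1)[OF w1(1)] _ j] by metis
      show ?thesis
      proof (cases "e = []")
        case True
        then have "a \<noteq> 0" using e w1(2,3) by (cases a) auto
        then show ?thesis using zero(1)[OF e(2), of "a - 1"] w1(1) e(1) True by simp
      next
        case False
        then show ?thesis using zero(2)[OF e(2), of a] w1(1) e by simp
      qed
    qed
  qed
qed

section \<open>Simplicity of the induced module\<close>

lemma exists_vector:
  assumes W: "F.subspace W" "K \<subseteq> W" "\<And>x f. f \<in> W \<Longrightarrow> lact x f \<in> W" "W \<subseteq> indF"
    and f: "f \<in> W" "f \<notin> K"
  shows "\<exists>v. v \<noteq> 0 \<and> single [] v \<in> W"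
proof -
  have fK: "f - NF f \<in> K" and fN: "NF f \<in> N" using indF_NF f(1) W(4) by auto
  let ?A = "wt ` {w. NF f w \<noteq> 0}"
  define n where "n = Max ?A"
  \<comment> \<open>The component of maximal weight of the normal form of \<open>f\<close> starts
    the descent.\<close>
  define \<sigma> where "\<sigma> = (\<lambda>w. if wt w = n then NF f w else 0)"
  have "NF f \<noteq> 0"
  proof
    assume "NF f = 0"
    then show False using fK f(2) by (simp only: diff_zero)
  qed
  then have ne: "?A \<noteq> {}" by (auto simp: fun_eq_iff)
  have finS: "finite {w. NF f w \<noteq> 0}" using fN by (simp add: N_def indF_def)
  then have fin: "finite ?A" by simp
  obtain w0 where w0: "NF f w0 \<noteq> 0" "wt w0 = n" using Max_in[OF fin ne] by (auto simp: n_def)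
  have "\<sigma> w0 \<noteq> 0" using w0 by (simp add: \<sigma>_def)
  then have \<sigma>0: "\<sigma> \<noteq> 0" by auto
  have \<sigma>hom: "\<sigma> \<in> homog n"
  proof -
    have "finite {w. \<sigma> w \<noteq> 0}"
      by (rule finite_subset[OF _ finS]) (auto simp: \<sigma>_def split: if_splits)
    then show ?thesis
      using fN unfolding homog_def N_def indF_def by (auto simp: \<sigma>_def split: if_splits)
  qed
  then have "NF f - \<sigma> \<in> indF" using fN F.subspace_diff[OF subspace_indF] by (auto simp: homog_def N_def)
  then have "NF f - \<sigma> \<in> Fil (n - 1)"
  proof (rule indF_mem_subspace[OF _ Fil_subspace])
    fix w assume w: "(NF f - \<sigma>) w \<noteq> 0"
    then have "NF f w \<noteq> 0" "wt w \<noteq> n" by (auto simp: \<sigma>_def split: if_splits)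
    then have "wt w \<le> n - 1" "normal w"
      using Max_ge[OF fin, of "wt w"] fN by (auto simp: n_def N_def)
    then show "single w ((NF f - \<sigma>) w) \<in> Fil (n - 1)" by (intro single_Fil) (simp_all add: normal_iff)
  qed
  then have "eqv (n - 1) (NF f) \<sigma>" by (simp only: eqv_def)
  then have "eqv (n - 1) f \<sigma>" using eqv_trans eqv_K[OF fK] by blast
  then show ?thesis using lowest_component[OF W(1-3) f(1) \<sigma>hom \<sigma>0] by blast
qed

text \<open>The homogeneous parts of \<open>single [] v\<close> are given only modulo
  \<open>K\<close>; normal forms make the decomposition exact. At a nonempty word the two parts
  cancel, so both lie in the intersection of \<open>V0\<close> and \<open>V1\<close>, which is 0.
  Hence both parts come from V.\<close>

lemma graded_part:
  assumes W: "F.subspace W" "K \<subseteq> W" "W \<subseteq> indF" and v: "single [] v \<in> W"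
    and f: "f0 \<in> W \<inter> indF_par V0 V1 False" "f1 \<in> W \<inter> indF_par V0 V1 True" "single [] v - (f0 + f1) \<in> K"
  shows "\<exists>a b. single [] a \<in> W \<and> a \<in> V0 \<and> single [] b \<in> W \<and> b \<in> V1 \<and> v = a + b"
proof -
  have F: "f0 \<in> indF" "f1 \<in> indF" using f W(3) by auto
  have "NF (single [] v - (f0 + f1)) = 0" using K_NF f(3) by blast
  moreover have "normal []" by (simp add: normal_iff)
  ultimately have eq: "single [] v = NF f0 + NF f1"
    using F single_indF[of "[]" v] F.subspace_add[OF subspace_indF F]
    by (simp only: NF_diff NF_add NF_single nf_normal eq_iff_diff_eq_0[symmetric])
  have par: "NF f0 w \<in> (if word_odd w then V1 else V0)" "NF f1 w \<in> (if word_odd w then V0 else V1)" for w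
    using NF_par[of f0 False] NF_par[of f1 True] f by (auto simp: indF_par_def split: if_splits)
  have int: "V0 \<inter> V1 = {0}" using rep by (simp add: b_supermodule_def)
  have zero: "NF f0 w = 0" "NF f1 w = 0" if "w \<noteq> []" for w
  proof -
    have "NF f0 w + NF f1 w = 0" using fun_cong[OF eq, of w] that by (simp add: single_apply)
    then have "NF f0 w = - NF f1 w" by (simp add: eq_neg_iff_add_eq_0)
    then have "NF f0 w \<in> V0 \<inter> V1"
      using par[of w] V.subspace_neg[OF V_subspace(1)] V.subspace_neg[OF V_subspace(2)] by (auto split: if_splits)
    then show "NF f0 w = 0" using int by auto
    then show "NF f1 w = 0" using \<open>NF f0 w + NF f1 w = 0\<close> by simp
  qed
  have "NF f0 = single [] (NF f0 [])" "NF f1 = single [] (NF f1 [])"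
    using zero by (auto simp: single_apply fun_eq_iff)
  moreover have "NF g \<in> W" if "g \<in> W" for g
  proof -
    have "g - NF g \<in> W" using indF_NF(1) that W(2,3) by blast
    from F.subspace_diff[OF W(1) that this] show ?thesis by (simp only: diff_diff_eq2 add_diff_cancel_left')
  qed
  ultimately have "single [] (NF f0 []) \<in> W" "single [] (NF f1 []) \<in> W" using f by (metis IntD1)+
  moreover have "v = NF f0 [] + NF f1 []" using fun_cong[OF eq, of "[]"] by (simp add: single_apply)
  moreover have "NF f0 [] \<in> V0" "NF f1 [] \<in> V1" using par[of "[]"] by auto
  ultimately show ?thesis by blast
qed

text \<open>V embeds into \<open>Ind(V)\<close>: the empty word is normal, so \<open>NF\<close>
  fixes its multiples, but it kills \<open>K\<close>.\<close>

lemma single_Nil_notin_K: "v \<noteq> 0 \<Longrightarrow> single [] v \<notin> K"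
proof
  assume "v \<noteq> 0" "single [] v \<in> K"
  then have "nf [] v = 0" using K_NF NF_single by metis
  moreover have "normal []" by (simp add: normal_iff)
  ultimately show False using \<open>v \<noteq> 0\<close> by (simp only: nf_normal single_eq_0_iff)
qed

lemma simple:
  assumes V: "simple_b_supermodule scale V0 V1 act"
  shows "ind_simple scale V0 V1 act"
  unfolding ind_simple_def Let_def
proof (intro conjI allI impI)
  obtain v :: 'v where "v \<noteq> 0" using V by (auto simp: simple_b_supermodule_def)
  then show "\<exists>f\<in>indF. f \<notin> K" using single_Nil_notin_K single_indF by blast
next
  fix W assume *: "K \<subseteq> W \<and> W \<subseteq> indF \<and>
            (\<forall>f\<in>W. \<forall>g\<in>W. f + g \<in> W) \<and> (\<forall>a. \<forall>f\<in>W. fscale scale a f \<in> W) \<and>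
            (\<forall>x. \<forall>f\<in>W. lact x f \<in> W) \<and>
            (\<forall>f\<in>W. \<exists>f0\<in>W \<inter> indF_par V0 V1 False. \<exists>f1\<in>W \<inter> indF_par V0 V1 True. f - (f0 + f1) \<in> K)"
  then have W: "K \<subseteq> W" "W \<subseteq> indF" "\<And>x f. f \<in> W \<Longrightarrow> lact x f \<in> W"
    and graded: "\<And>f. f \<in> W \<Longrightarrow> \<exists>f0\<in>W \<inter> indF_par V0 V1 False. \<exists>f1\<in>W \<inter> indF_par V0 V1 True. f - (f0 + f1) \<in> K"
    by auto
  have sub: "F.subspace W"
    using * F.subspace_0[OF K_subspace] by (intro F.subspaceI) auto
  show "W = K \<or> W = indF"
  proof (cases "W = K")
    case False
    then obtain f where "f \<in> W" "f \<notin> K" using W(1) by blast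
    from exists_vector[OF sub W(1,3,2) this] obtain v where v: "v \<noteq> 0" "single [] v \<in> W" by blast
    \<comment> \<open>The trace of \<open>W\<close> on V is a graded submodule over b and contains
      the nonzero \<open>v\<close>, so it is all of V, and V generates
      \<open>Ind(V)\<close>.\<close>
    define S where "S = {v. single [] v \<in> W}"
    have "V.subspace S"
    proof (rule V.subspaceI)
      have "single [] (0 :: 'v) = 0" by (simp only: single_eq_0_iff)
      then show "0 \<in> S"
        using F.subspace_0[OF sub] by (simp only: S_def mem_Collect_eq)
    qed (auto simp: S_def single_add single_scale F.subspace_add[OF sub] F.subspace_scale[OF sub])
    moreover have "act x ` S \<subseteq> S" if "in_b x" for x
    proof
      fix v' assume "v' \<in> act x ` S"
      then obtain v where v: "v' = act x v" "single [] v \<in> W" by (auto simp: S_def)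
      have "single [x] v \<in> W" using W(3)[OF v(2), of x] by (simp add: lact_single)
      moreover have "single ([] @ [x]) v - single [] (act x v) \<in> W" using K_absorb[OF that] W(1) by blast
      ultimately have "single [x] v - (single ([] @ [x]) v - single [] (act x v)) \<in> W"
        by (rule F.subspace_diff[OF sub])
      then show "v' \<in> S" by (simp add: S_def v(1))
    qed
    moreover have "\<exists>a\<in>S \<inter> V0. \<exists>b\<in>S \<inter> V1. v = a + b" if "v \<in> S" for v
      using graded[of "single [] v"] graded_part[OF sub W(1,2), of v] that unfolding S_def by blast
    ultimately have "S = {0} \<or> S = UNIV"
      using V unfolding simple_b_supermodule_def by blast
    then have S: "S = UNIV" using v by (auto simp: S_def)
    have "single w v \<in> W" for w v
    proof (induction w)
      case Nil
      show ?case using S by (auto simp: S_def)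
    next
      case (Cons x w)
      then show ?case using W(3)[of "single w v" x] by (simp add: lact_single)
    qed
    then have "indF \<subseteq> W" using indF_mem_subspace[OF _ sub] by blast
    then show ?thesis using W(2) by blast
  qed simp
qed

end

theorem theorem3p3:
  fixes scale :: "complex \<Rightarrow> 'v::ab_group_add \<Rightarrow> 'v"
    and V0 V1 :: "'v set"
    and act :: "rgen \<Rightarrow> 'v \<Rightarrow> 'v"
    and t :: int
  assumes "simple_b_supermodule scale V0 V1 act"
    and "t > 0"
    and "inj (act (RL t))"
    and "\<forall>i>t. \<forall>v. act (RL i) v = 0"
  shows "ind_is_R_module scale act \<and> ind_simple scale V0 V1 act \<and> ind_smooth scale act"
proof -
  interpret ind_rep scale V0 V1 act t
    using assms by unfold_locales (auto simp: simple_b_supermodule_def)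
  show ?thesis
    using lact_K simple[OF assms(1)] smooth by (simp add: ind_is_R_module_def)
qed

end
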